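(* Let $\Pi$ be a probability measure on a product $\mathcal X\times\mathcal Y$ of Polish spaces, let $P$ be the two-component deterministic-scan Gibbs kernel and $P_X$ its $X$-marginal kernel. Suppose that $P_X^*P_X$ satisfies a weak Poincaré inequality with function $\beta$: $$\|g\|_{\Pi_X}^2\le s\,\mathcal E_{\Pi_X}(P_X^*P_X,g)+\beta(s)\|g\|_{\mathrm{osc}}^2\qquad\forall s>0,\ g\in L^2_0(\Pi_X),$$ and let $K^*$ be associated with $\beta$. Then for every $f\in L^2_0(\Pi)$ with $0<\|f\|_{\mathrm{osc}}<\infty$ (and $\|Pf\|_{\mathrm{osc}}>0$ for the first inequality), $$\frac{\mathcal E_\Pi(P^*P,Pf)}{\|Pf\|_{\mathrm{osc}}^2}\ \ge\ K^*\!\left(\frac{\|Pf\|_\Pi^2}{\|Pf\|_{\mathrm{osc}}^2}\right).$$ Hence, for every integer $n\ge2$, $$\|P^nf\|_\Pi^2\le\|f\|_{\mathrm{osc}}^2\,F^{-1}(n-1),$$ where $F:(0,1/4]\to\mathbb R$, $F(x)=\int_x^{1/4}\frac{dv}{K^*(v)}$.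
   Context: For a probability measure $\mu$: $L^2_0(\mu)$ is the space of mean-zero functions in $L^2(\mu)$, $\|f\|_\mu^2=\int f^2d\mu$, $\|f\|_{\mathrm{osc}}=\operatorname{ess\,sup}_\mu f-\operatorname{ess\,inf}_\mu f$. A $\mu$-invariant Markov kernel $T$ acts by $(Tf)(x)=\int f(x')T(x,dx')$, $T^*$ is its $L^2(\mu)$-adjoint, and $\mathcal E_\mu(T,f)=\langle (I-T)f,f\rangle_\mu$. In a weak Poincaré inequality $\beta:(0,\infty)\to[0,\infty)$ is decreasing with $\lim_{s\to\infty}\beta(s)=0$ (without loss of generality $\beta\le1/4$). The function $K^*$ associated with $\beta$ is $K^*(v)=\sup_{u\ge0}\{uv-K(u)\}$, where $K(u)=u\,\beta(1/u)$ for $u>0$ and $K(0)=0$. Standing convention: $\beta$ is normalised so that $K^*(v)\le v$ for $v\in[0,1/4]$; then $F$ is a decreasing bijection from $(0,1/4]$ onto $[0,\infty)$. $\Pi_X,\Pi_Y$ are the marginals of $\Pi$ and $\Pi_{Y|X},\Pi_{X|Y}$ the conditionals. The deterministic-scan Gibbs kernel is $P((x,y),(dx',dy'))=\Pi_{Y|X}(dy'|x)\,\Pi_{X|Y}(dx'|y')$, and the $X$-marginal kernel is $P_X(x,dx')=\int_{\mathcal Y}\Pi_{X|Y}(dx'|y)\,\Pi_{Y|X}(dy|x)$, which is $\Pi_X$-reversible. *)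

theory Defs
  imports "HOL-Probability.Probability"
begin

definition L2 :: "'a measure \<Rightarrow> ('a \<Rightarrow> real) set" where
  "L2 \<mu> = {f \<in> borel_measurable \<mu>. integrable \<mu> (\<lambda>x. (f x)\<^sup>2)}"

definition L20 :: "'a measure \<Rightarrow> ('a \<Rightarrow> real) set" where
  "L20 \<mu> = {f \<in> L2 \<mu>. (\<integral>x. f x \<partial>\<mu>) = 0}"

definition L2_inner :: "'a measure \<Rightarrow> ('a \<Rightarrow> real) \<Rightarrow> ('a \<Rightarrow> real) \<Rightarrow> real" where
  "L2_inner \<mu> f g = (\<integral>x. f x * g x \<partial>\<mu>)"

definition L2_norm :: "'a measure \<Rightarrow> ('a \<Rightarrow> real) \<Rightarrow> real" where
  "L2_norm \<mu> f = sqrt (\<integral>x. (f x)\<^sup>2 \<partial>\<mu>)"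

definition essinf :: "'a measure \<Rightarrow> ('a \<Rightarrow> ereal) \<Rightarrow> ereal" where
  "essinf \<mu> f = - esssup \<mu> (\<lambda>x. - f x)"

definition osc :: "'a measure \<Rightarrow> ('a \<Rightarrow> real) \<Rightarrow> ereal" where
  "osc \<mu> f = esssup \<mu> (\<lambda>x. ereal (f x)) - essinf \<mu> (\<lambda>x. ereal (f x))"

definition kernel_op :: "('a \<Rightarrow> 'b measure) \<Rightarrow> ('b \<Rightarrow> real) \<Rightarrow> 'a \<Rightarrow> real" where
  "kernel_op T f x = (\<integral>x'. f x' \<partial>T x)"

text \<open>Elements of \<open>L2 \<mu>\<close> are functions rather than almost-everywhere classes, so the adjoint
  is determined up to null sets only; the choice selects one version.\<close>

definition L2_adjoint :: "'a measure \<Rightarrow> (('a \<Rightarrow> real) \<Rightarrow> 'a \<Rightarrow> real) \<Rightarrow> (('a \<Rightarrow> real) \<Rightarrow> 'a \<Rightarrow> real)" where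
  "L2_adjoint \<mu> T = (SOME S. \<forall>g\<in>L2 \<mu>. S g \<in> L2 \<mu> \<and>
     (\<forall>f\<in>L2 \<mu>. L2_inner \<mu> (T f) g = L2_inner \<mu> f (S g)))"

definition dirichlet :: "'a measure \<Rightarrow> (('a \<Rightarrow> real) \<Rightarrow> 'a \<Rightarrow> real) \<Rightarrow> ('a \<Rightarrow> real) \<Rightarrow> real" where
  "dirichlet \<mu> T f = L2_inner \<mu> (\<lambda>x. f x - T f x) f"

text \<open>Only the values of \<open>\<beta>\<close> on \<open>(0, \<infinity>)\<close> matter. The oscillation of \<open>g\<close> may be infinite, whence the
  extended real inequality (with \<open>0 * \<infinity> = 0\<close>).\<close>

definition weak_poincare ::
    "'a measure \<Rightarrow> (('a \<Rightarrow> real) \<Rightarrow> 'a \<Rightarrow> real) \<Rightarrow> (real \<Rightarrow> real) \<Rightarrow> bool" where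
  "weak_poincare \<mu> T \<beta> \<longleftrightarrow>
     (\<forall>s>0. 0 \<le> \<beta> s) \<and> antimono_on {0<..} \<beta> \<and> (\<beta> \<longlongrightarrow> 0) at_top \<and>
     (\<forall>s>0. \<forall>g\<in>L20 \<mu>.
        ereal ((L2_norm \<mu> g)\<^sup>2) \<le> ereal (s * dirichlet \<mu> T g) + ereal (\<beta> s) * (osc \<mu> g)\<^sup>2)"

definition wpi_K :: "(real \<Rightarrow> real) \<Rightarrow> real \<Rightarrow> real" where
  "wpi_K \<beta> u = (if u = 0 then 0 else u * \<beta> (1 / u))"

definition wpi_Kstar :: "(real \<Rightarrow> real) \<Rightarrow> real \<Rightarrow> ereal" where
  "wpi_Kstar \<beta> v = (SUP u\<in>{0..}. ereal (u * v - wpi_K \<beta> u))"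

definition wpi_F :: "(real \<Rightarrow> real) \<Rightarrow> real \<Rightarrow> real" where
  "wpi_F \<beta> x = integral {x..1/4} (\<lambda>v. 1 / real_of_ereal (wpi_Kstar \<beta> v))"

definition wpi_F_inv :: "(real \<Rightarrow> real) \<Rightarrow> real \<Rightarrow> real" where
  "wpi_F_inv \<beta> = the_inv_into {0<..1/4} (wpi_F \<beta>)"

text \<open>\<open>\<kappa>\<close> is a version of the regular conditional distribution of \<open>V\<close> given \<open>U\<close> under \<open>\<pi>\<close>.\<close>

definition regular_conditional ::
    "'a measure \<Rightarrow> ('a \<Rightarrow> 'u::topological_space) \<Rightarrow> ('a \<Rightarrow> 'v::topological_space) \<Rightarrow>
     ('u \<Rightarrow> 'v measure) \<Rightarrow> bool" where
  "regular_conditional \<pi> U V \<kappa> \<longleftrightarrow>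
     \<kappa> \<in> borel \<rightarrow>\<^sub>M prob_algebra borel \<and>
     (\<forall>A\<in>sets borel. \<forall>B\<in>sets borel.
        emeasure \<pi> {\<omega> \<in> space \<pi>. U \<omega> \<in> A \<and> V \<omega> \<in> B} =
        (\<integral>\<^sup>+u\<in>A. emeasure (\<kappa> u) B \<partial>distr \<pi> borel U))"

text \<open>In the two kernels below, \<open>\<kappa>Y x\<close> is the conditional law of \<open>Y\<close> given \<open>X = x\<close> and
  \<open>\<kappa>X y\<close> that of \<open>X\<close> given \<open>Y = y\<close>.\<close>

definition gibbs_kernel ::
    "('x::topological_space \<Rightarrow> 'y::topological_space measure) \<Rightarrow> ('y \<Rightarrow> 'x measure) \<Rightarrow>
     'x \<times> 'y \<Rightarrow> ('x \<times> 'y) measure" where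
  "gibbs_kernel \<kappa>Y \<kappa>X = (\<lambda>(x, y). \<kappa>Y x \<bind> (\<lambda>y'. \<kappa>X y' \<bind> (\<lambda>x'. return borel (x', y'))))"

definition marginal_kernel ::
    "('x \<Rightarrow> 'y measure) \<Rightarrow> ('y \<Rightarrow> 'x measure) \<Rightarrow> 'x \<Rightarrow> 'x measure" where
  "marginal_kernel \<kappa>Y \<kappa>X x = \<kappa>Y x \<bind> \<kappa>X"

end

theory Submission
  imports Defs
begin

text \<open>\<open>P f\<close> depends on the first coordinate only, say \<open>P f = h \<circ> fst\<close>, and \<open>P\<close> acts on such functions as
  \<open>P\<^sub>X\<close>. Hence the Dirichlet form of \<open>P\<^sup>*P\<close> at \<open>P f\<close> equals \<open>\<parallel>h\<parallel>\<^sup>2 - \<parallel>P\<^sub>X h\<parallel>\<^sup>2\<close>, which is the Dirichlet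
  form of \<open>P\<^sub>X\<^sup>*P\<^sub>X\<close> at \<open>h\<close>, and the weak Poincare inequality for \<open>h\<close>, optimised over \<open>s\<close>, is the
  first claim. Applied to \<open>P\<^sub>X\<^sup>n h\<close>, whose oscillation is at most \<open>r = \<parallel>f\<parallel>\<^sub>o\<^sub>s\<^sub>c\<close>, it yields
  \<open>K\<^sup>*(v\<^sub>n) \<le> v\<^sub>n - v\<^sub>n\<^sub>+\<^sub>1\<close> for \<open>v\<^sub>n = \<parallel>P\<^sub>X\<^sup>n h\<parallel>\<^sup>2 / r\<^sup>2\<close>, where \<open>v\<^sub>0 \<le> 1/4\<close> by Popoviciu's inequality, and
  each step increases \<open>F\<close> by at least \<open>1\<close>.\<close>

section \<open>Adjoint Markov kernels\<close>

text \<open>Since the test functions take values in \<open>[0, \<infinity>]\<close>, adjoint pairs compose without integrability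
  conditions.\<close>

definition adjoint_kernels ::
    "'a measure \<Rightarrow> 'b measure \<Rightarrow> ('a \<Rightarrow> 'b measure) \<Rightarrow> ('b \<Rightarrow> 'a measure) \<Rightarrow> bool" where
  "adjoint_kernels \<mu> \<nu> T S \<longleftrightarrow>
     T \<in> \<mu> \<rightarrow>\<^sub>M prob_algebra \<nu> \<and> S \<in> \<nu> \<rightarrow>\<^sub>M prob_algebra \<mu> \<and>
     (\<forall>a\<in>borel_measurable \<mu>. \<forall>b\<in>borel_measurable \<nu>.
        (\<integral>\<^sup>+x. a x * (\<integral>\<^sup>+y. b y \<partial>T x) \<partial>\<mu>) = (\<integral>\<^sup>+y. (\<integral>\<^sup>+x. a x \<partial>S y) * b y \<partial>\<nu>))"

lemma adjoint_kernels_sym: "adjoint_kernels \<mu> \<nu> T S \<Longrightarrow> adjoint_kernels \<nu> \<mu> S T"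
  by (simp add: adjoint_kernels_def mult.commute)

lemma borel_measurable_nn_integral_kernel:
  assumes "T \<in> M \<rightarrow>\<^sub>M prob_algebra N" and "b \<in> borel_measurable N"
  shows "(\<lambda>x. \<integral>\<^sup>+y. b y \<partial>T x) \<in> borel_measurable M"
  using measurable_compose[OF measurable_prob_algebraD[OF assms(1)]
      nn_integral_measurable_subprob_algebra[OF assms(2)]] .

lemma kernel_op_measurable:
  assumes "T \<in> M \<rightarrow>\<^sub>M prob_algebra N" and "f \<in> borel_measurable N"
  shows "kernel_op T f \<in> borel_measurable M"
  unfolding kernel_op_def
  using measurable_compose[OF measurable_prob_algebraD[OF assms(1)]
      integral_measurable_subprob_algebra[OF assms(2)]] .

text \<open>Both sides equal the integral over \<open>\<nu>\<close> of \<open>S\<close> applied to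
  \<open>a\<close> times \<open>T'\<close> applied to \<open>b\<close>: the first adjoint pair moves
  \<open>T\<close> onto \<open>a\<close>, the second moves \<open>T'\<close>. The adjoints therefore
  compose in reverse order.\<close>

lemma adjoint_kernels_bind:
  assumes 1: "adjoint_kernels \<mu> \<nu> T S" and 2: "adjoint_kernels \<nu> \<rho> T' S'"
  shows "adjoint_kernels \<mu> \<rho> (\<lambda>x. T x \<bind> T') (\<lambda>z. S' z \<bind> S)"
  unfolding adjoint_kernels_def
proof (intro conjI ballI)
  from 1 2 have T: "T \<in> \<mu> \<rightarrow>\<^sub>M prob_algebra \<nu>" "S \<in> \<nu> \<rightarrow>\<^sub>M prob_algebra \<mu>"
    "T' \<in> \<nu> \<rightarrow>\<^sub>M prob_algebra \<rho>" "S' \<in> \<rho> \<rightarrow>\<^sub>M prob_algebra \<nu>"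
    by (auto simp: adjoint_kernels_def)
  show "(\<lambda>x. T x \<bind> T') \<in> \<mu> \<rightarrow>\<^sub>M prob_algebra \<rho>" "(\<lambda>z. S' z \<bind> S) \<in> \<rho> \<rightarrow>\<^sub>M prob_algebra \<mu>"
    using T by (auto intro: measurable_bind_prob_space)
  fix a b :: "_ \<Rightarrow> ennreal" assume a: "a \<in> borel_measurable \<mu>" and b: "b \<in> borel_measurable \<rho>"
  let ?b = "\<lambda>y. \<integral>\<^sup>+z. b z \<partial>T' y" and ?a = "\<lambda>y. \<integral>\<^sup>+x. a x \<partial>S y"
  have m: "?a \<in> borel_measurable \<nu>" "?b \<in> borel_measurable \<nu>"
    using T a b by (auto intro: borel_measurable_nn_integral_kernel)
  have sets: "sets (T x) = sets \<nu>" if "x \<in> space \<mu>" for x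
    using measurable_space[OF T(1) that] by (simp add: space_prob_algebra)
  have sets': "sets (S' z) = sets \<nu>" if "z \<in> space \<rho>" for z
    using measurable_space[OF T(4) that] by (simp add: space_prob_algebra)
  have "(\<integral>\<^sup>+x. a x * (\<integral>\<^sup>+z. b z \<partial>(T x \<bind> T')) \<partial>\<mu>) = (\<integral>\<^sup>+x. a x * (\<integral>\<^sup>+y. ?b y \<partial>T x) \<partial>\<mu>)"
    using T b by (intro nn_integral_cong arg_cong2[where f="(*)"] refl nn_integral_bind[where B=\<rho>])
      (auto cong: measurable_cong_sets simp: sets intro!: measurable_prob_algebraD)
  also have "\<dots> = (\<integral>\<^sup>+y. ?a y * ?b y \<partial>\<nu>)"
    using 1 a m by (auto simp: adjoint_kernels_def)
  also have "\<dots> = (\<integral>\<^sup>+z. (\<integral>\<^sup>+y. ?a y \<partial>S' z) * b z \<partial>\<rho>)"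
    using 2 b m by (auto simp: adjoint_kernels_def)
  also have "\<dots> = (\<integral>\<^sup>+z. (\<integral>\<^sup>+x. a x \<partial>(S' z \<bind> S)) * b z \<partial>\<rho>)"
    using T a by (intro nn_integral_cong arg_cong2[where f="(*)"] refl nn_integral_bind[where B=\<mu>, symmetric])
      (auto cong: measurable_cong_sets simp: sets' intro!: measurable_prob_algebraD)
  finally show "(\<integral>\<^sup>+x. a x * (\<integral>\<^sup>+z. b z \<partial>(T x \<bind> T')) \<partial>\<mu>) =
      (\<integral>\<^sup>+z. (\<integral>\<^sup>+x. a x \<partial>(S' z \<bind> S)) * b z \<partial>\<rho>)" .
qed

lemma kernel_prob:
  assumes "T \<in> M \<rightarrow>\<^sub>M prob_algebra N" "x \<in> space M"
  shows "prob_space (T x)" "sets (T x) = sets N" "space (T x) = space N"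
  using measurable_space[OF assms] by (auto simp: space_prob_algebra dest: sets_eq_imp_space_eq)

text \<open>Testing the duality with \<open>a = 1\<close> suffices, because \<open>S\<close> is
  Markov and so maps 1 to 1. For \<open>\<mu> = \<nu>\<close> this is the invariance of the measure
  under \<open>T\<close>.\<close>

lemma adjoint_kernels_nn_integral:
  assumes A: "adjoint_kernels \<mu> \<nu> T S" and b: "b \<in> borel_measurable \<nu>"
  shows "(\<integral>\<^sup>+x. \<integral>\<^sup>+y. b y \<partial>T x \<partial>\<mu>) = (\<integral>\<^sup>+y. b y \<partial>\<nu>)"
proof -
  have S: "S \<in> \<nu> \<rightarrow>\<^sub>M prob_algebra \<mu>" using A by (simp add: adjoint_kernels_def)
  have "(\<integral>\<^sup>+x. (\<lambda>_. 1) x * (\<integral>\<^sup>+y. b y \<partial>T x) \<partial>\<mu>) = (\<integral>\<^sup>+y. (\<integral>\<^sup>+x. 1 \<partial>S y) * b y \<partial>\<nu>)"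
    using A b unfolding adjoint_kernels_def by fastforce
  also have "\<dots> = (\<integral>\<^sup>+y. b y \<partial>\<nu>)"
    by (intro nn_integral_cong)
      (simp add: prob_space.emeasure_space_1[OF kernel_prob(1)[OF S]])
  finally show ?thesis by simp
qed

text \<open>Since \<open>T\<close> carries \<open>\<mu>\<close> to \<open>\<nu>\<close>, the
  \<open>T x\<close>-measure of a \<open>\<nu>\<close>-null set integrates to 0 and thus vanishes
  for almost every \<open>x\<close>.\<close>

lemma adjoint_kernels_AE:
  assumes A: "adjoint_kernels \<mu> \<nu> T S" and P: "AE y in \<nu>. P y"
  shows "AE x in \<mu>. AE y in T x. P y"
proof -
  have T: "T \<in> \<mu> \<rightarrow>\<^sub>M prob_algebra \<nu>" using A by (simp add: adjoint_kernels_def)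
  obtain N where N: "N \<in> sets \<nu>" "emeasure \<nu> N = 0" "{y\<in>space \<nu>. \<not> P y} \<subseteq> N"
    using P by (auto elim!: AE_E)
  have "(\<integral>\<^sup>+x. \<integral>\<^sup>+y. indicator N y \<partial>T x \<partial>\<mu>) = 0"
    using adjoint_kernels_nn_integral[OF A, of "indicator N"] N by simp
  then have "AE x in \<mu>. (\<integral>\<^sup>+y. indicator N y \<partial>T x) = 0"
    using borel_measurable_nn_integral_kernel[OF T] N by (subst (asm) nn_integral_0_iff_AE) auto
  with AE_space show ?thesis
  proof eventually_elim
    case (elim x)
    then show ?case
      using N kernel_prob[OF T elim(1)] by (intro AE_I[of _ _ N]) auto
  qed
qed

section \<open>Markov kernels as operators on square-integrable functions\<close>

lemma L2D:
  assumes "f \<in> L2 \<mu>"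
  shows "f \<in> borel_measurable \<mu>" "integrable \<mu> (\<lambda>x. (f x)\<^sup>2)"
  using assms by (auto simp: L2_def)

lemma L2_mult_integrable:
  assumes "f \<in> L2 \<mu>" "g \<in> L2 \<mu>"
  shows "integrable \<mu> (\<lambda>x. f x * g x)"
proof (rule Bochner_Integration.integrable_bound)
  show "integrable \<mu> (\<lambda>x. (f x)\<^sup>2 + (g x)\<^sup>2)" using assms by (auto dest: L2D)
  show "(\<lambda>x. f x * g x) \<in> borel_measurable \<mu>"
    by (intro borel_measurable_times L2D assms)
  have "norm (f x * g x) \<le> norm ((f x)\<^sup>2 + (g x)\<^sup>2)" for x
    using sum_squares_bound[of "\<bar>f x\<bar>" "\<bar>g x\<bar>"] mult_nonneg_nonneg[of "\<bar>f x\<bar>" "\<bar>g x\<bar>"]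
    unfolding real_norm_def abs_mult power2_abs by linarith
  then show "AE x in \<mu>. norm (f x * g x) \<le> norm ((f x)\<^sup>2 + (g x)\<^sup>2)" by simp
qed

lemma (in finite_measure) L2_integrable:
  assumes "f \<in> L2 M"
  shows "integrable M f"
  using L2_mult_integrable[OF assms, of "\<lambda>_. 1"] by (simp add: L2_def)

lemma nn_integral_square_finite_imp_L2:
  assumes "f \<in> borel_measurable \<mu>" "(\<integral>\<^sup>+x. ennreal ((f x)\<^sup>2) \<partial>\<mu>) < \<infinity>"
  shows "f \<in> L2 \<mu>"
  using assms unfolding L2_def by (auto intro!: integrableI_nonneg)

text \<open>The variance is nonnegative. With an extended right-hand side the bound also covers
  functions outside \<open>L2\<close>, for which that side is infinite.\<close>

lemma (in prob_space) square_integral_le: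
  assumes f: "f \<in> borel_measurable M"
  shows "ennreal ((\<integral>x. f x \<partial>M)\<^sup>2) \<le> (\<integral>\<^sup>+x. ennreal ((f x)\<^sup>2) \<partial>M)"
proof (cases "(\<integral>\<^sup>+x. ennreal ((f x)\<^sup>2) \<partial>M) < \<infinity>")
  case True
  then have L: "f \<in> L2 M" using nn_integral_square_finite_imp_L2[OF f] by simp
  have "(\<integral>x. f x \<partial>M)\<^sup>2 \<le> (\<integral>x. (f x)\<^sup>2 \<partial>M)"
    using variance_eq[OF L2_integrable[OF L] L2D(2)[OF L]] variance_positive[of f] by simp
  also have "ennreal (\<integral>x. (f x)\<^sup>2 \<partial>M) = (\<integral>\<^sup>+x. ennreal ((f x)\<^sup>2) \<partial>M)"
    using L by (intro nn_integral_eq_integral[symmetric]) (auto dest: L2D)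
  finally show ?thesis by (simp add: ennreal_leI)
qed (auto simp: not_less top_unique)

text \<open>The square inequality under each \<open>T x\<close>, integrated over
  \<open>\<mu>\<close>, gives the contraction. The third part says where
  \<open>kernel_op T f x\<close> is a genuine integral and not the default value 0 of a
  nonintegrable function.\<close>

lemma kernel_op_L2:
  assumes A: "adjoint_kernels \<mu> \<nu> T S" and f: "f \<in> L2 \<nu>"
  shows "kernel_op T f \<in> L2 \<mu>" and "(\<integral>x. (kernel_op T f x)\<^sup>2 \<partial>\<mu>) \<le> (\<integral>y. (f y)\<^sup>2 \<partial>\<nu>)"
    and "AE x in \<mu>. f \<in> L2 (T x)"
proof -
  have T: "T \<in> \<mu> \<rightarrow>\<^sub>M prob_algebra \<nu>" using A by (simp add: adjoint_kernels_def)
  note fm[measurable] = L2D(1)[OF f]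
  have mT: "f \<in> borel_measurable (T x)" if "x \<in> space \<mu>" for x
    using fm kernel_prob(2)[OF T that] by (simp cong: measurable_cong_sets)
  have inv: "(\<integral>\<^sup>+x. \<integral>\<^sup>+y. ennreal ((f y)\<^sup>2) \<partial>T x \<partial>\<mu>) = (\<integral>\<^sup>+y. ennreal ((f y)\<^sup>2) \<partial>\<nu>)"
    by (rule adjoint_kernels_nn_integral[OF A]) measurable
  also have eq: "\<dots> = ennreal (\<integral>y. (f y)\<^sup>2 \<partial>\<nu>)"
    using f by (intro nn_integral_eq_integral) (auto dest: L2D)
  finally have fin: "(\<integral>\<^sup>+x. \<integral>\<^sup>+y. ennreal ((f y)\<^sup>2) \<partial>T x \<partial>\<mu>) = ennreal (\<integral>y. (f y)\<^sup>2 \<partial>\<nu>)" .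
  have le: "(\<integral>\<^sup>+x. ennreal ((kernel_op T f x)\<^sup>2) \<partial>\<mu>) \<le> ennreal (\<integral>y. (f y)\<^sup>2 \<partial>\<nu>)"
    unfolding fin[symmetric] kernel_op_def
    by (intro nn_integral_mono prob_space.square_integral_le kernel_prob[OF T] mT)
  then show L: "kernel_op T f \<in> L2 \<mu>"
    using kernel_op_measurable[OF T fm]
    by (intro nn_integral_square_finite_imp_L2) (auto simp: le_less_trans)
  from le show "(\<integral>x. (kernel_op T f x)\<^sup>2 \<partial>\<mu>) \<le> (\<integral>y. (f y)\<^sup>2 \<partial>\<nu>)"
    by (subst (asm) nn_integral_eq_integral) (auto intro: L2D[OF L] simp: ennreal_le_iff)
  have "AE x in \<mu>. (\<integral>\<^sup>+y. ennreal ((f y)\<^sup>2) \<partial>T x) \<noteq> \<infinity>"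
    using fin borel_measurable_nn_integral_kernel[OF T]
    by (intro nn_integral_PInf_AE) auto
  then show "AE x in \<mu>. f \<in> L2 (T x)"
    by (rule AE_mp) (intro AE_I2 impI nn_integral_square_finite_imp_L2 mT, auto simp: less_top)
qed

lemma L2_inner_diff_left:
  assumes "f \<in> L2 \<mu>" "g \<in> L2 \<mu>" "h \<in> L2 \<mu>"
  shows "L2_inner \<mu> (\<lambda>x. f x - g x) h = L2_inner \<mu> f h - L2_inner \<mu> g h"
  using assms by (simp add: L2_inner_def left_diff_distrib L2_mult_integrable)

lemma L2_inner_commute: "L2_inner \<mu> f g = L2_inner \<mu> g f"
  by (simp add: L2_inner_def mult.commute)

text \<open>This links the real inner product to the extended integrals in
  \<open>adjoint_kernels\<close>. The two integrands may differ where \<open>g\<close> is not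
  integrable under \<open>T x\<close>, but such \<open>x\<close> form a null set.\<close>

lemma L2_inner_kernel_nonneg:
  assumes A: "adjoint_kernels \<mu> \<nu> T S" and f: "f \<in> L2 \<mu>" and g: "g \<in> L2 \<nu>"
    and nonneg: "\<And>x. 0 \<le> f x" "\<And>y. 0 \<le> g y"
  shows "ennreal (L2_inner \<mu> f (kernel_op T g)) = (\<integral>\<^sup>+x. ennreal (f x) * (\<integral>\<^sup>+y. ennreal (g y) \<partial>T x) \<partial>\<mu>)"
proof -
  have T: "T \<in> \<mu> \<rightarrow>\<^sub>M prob_algebra \<nu>" using A by (simp add: adjoint_kernels_def)
  have "ennreal (L2_inner \<mu> f (kernel_op T g)) = (\<integral>\<^sup>+x. ennreal (f x * kernel_op T g x) \<partial>\<mu>)"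
    unfolding L2_inner_def
    using nonneg by (intro nn_integral_eq_integral[symmetric] L2_mult_integrable kernel_op_L2[OF A g] f)
      (auto simp: kernel_op_def)
  also have "\<dots> = (\<integral>\<^sup>+x. ennreal (f x) * (\<integral>\<^sup>+y. ennreal (g y) \<partial>T x) \<partial>\<mu>)"
  proof (intro nn_integral_cong_AE, use kernel_op_L2(3)[OF A g] in \<open>rule AE_mp\<close>, intro AE_I2 impI)
    fix x assume x: "x \<in> space \<mu>" and L: "g \<in> L2 (T x)"
    interpret prob_space "T x" using kernel_prob[OF T x] by simp
    have "ennreal (kernel_op T g x) = (\<integral>\<^sup>+y. ennreal (g y) \<partial>T x)"
      unfolding kernel_op_def using nonneg
      by (intro nn_integral_eq_integral[symmetric] L2_integrable L) auto
    then show "ennreal (f x * kernel_op T g x) = ennreal (f x) * (\<integral>\<^sup>+y. ennreal (g y) \<partial>T x)"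
      using nonneg by (simp add: ennreal_mult kernel_op_def)
  qed
  finally show ?thesis .
qed

lemma L2_inner_kernel_op_nonneg:
  assumes A: "adjoint_kernels \<mu> \<nu> T S" and f: "f \<in> L2 \<mu>" and g: "g \<in> L2 \<nu>"
    and nonneg: "\<And>x. 0 \<le> f x" "\<And>y. 0 \<le> g y"
  shows "L2_inner \<mu> f (kernel_op T g) = L2_inner \<nu> (kernel_op S f) g"
proof -
  have "ennreal (L2_inner \<mu> f (kernel_op T g)) = ennreal (L2_inner \<nu> g (kernel_op S f))"
    unfolding L2_inner_kernel_nonneg[OF A f g nonneg]
      L2_inner_kernel_nonneg[OF adjoint_kernels_sym[OF A] g f nonneg(2,1)]
    using A L2D(1)[OF f] L2D(1)[OF g] by (simp add: adjoint_kernels_def mult.commute)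
  then show ?thesis
    using nonneg by (subst (asm) ennreal_inj)
      (auto simp: L2_inner_def kernel_op_def mult.commute intro!: integral_nonneg mult_nonneg_nonneg)
qed

text \<open>Linearity of \<open>kernel_op T\<close> holds only almost everywhere, namely where both
  functions are integrable under \<open>T x\<close>; the inner product does not see the exceptional
  set.\<close>

lemma L2_inner_kernel_op_diff:
  assumes A: "adjoint_kernels \<mu> \<nu> T S" and f: "f \<in> L2 \<mu>" and g: "g \<in> L2 \<nu>" "h \<in> L2 \<nu>"
  shows "L2_inner \<mu> f (kernel_op T (\<lambda>y. g y - h y)) =
    L2_inner \<mu> f (kernel_op T g) - L2_inner \<mu> f (kernel_op T h)"
proof -
  have T: "T \<in> \<mu> \<rightarrow>\<^sub>M prob_algebra \<nu>" using A by (simp add: adjoint_kernels_def)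
  have "L2_inner \<mu> f (kernel_op T (\<lambda>y. g y - h y)) =
    L2_inner \<mu> f (\<lambda>x. kernel_op T g x - kernel_op T h x)"
    unfolding L2_inner_def
  proof (rule integral_cong_AE)
    have "AE x in \<mu>. kernel_op T (\<lambda>y. g y - h y) x = kernel_op T g x - kernel_op T h x"
      using kernel_op_L2(3)[OF A g(1)] kernel_op_L2(3)[OF A g(2)] AE_space
    proof eventually_elim
      case (elim x)
      interpret prob_space "T x" using kernel_prob[OF T elim(3)] by simp
      show ?case using elim by (simp add: kernel_op_def L2_integrable)
    qed
    then show "AE x in \<mu>. f x * kernel_op T (\<lambda>y. g y - h y) x = f x * (kernel_op T g x - kernel_op T h x)"
      by eventually_elim simp
  qed (use f g in \<open>auto intro!: borel_measurable_times borel_measurable_diff kernel_op_measurable[OF T] dest: L2D\<close>)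
  also have "\<dots> = L2_inner \<mu> f (kernel_op T g) - L2_inner \<mu> f (kernel_op T h)"
    using L2_inner_diff_left[OF kernel_op_L2(1)[OF A g(1)] kernel_op_L2(1)[OF A g(2)] f]
    by (simp add: L2_inner_commute)
  finally show ?thesis .
qed

lemma L2_pos_part: "f \<in> L2 \<mu> \<Longrightarrow> (\<lambda>x. max 0 (f x)) \<in> L2 \<mu>"
  unfolding L2_def
  by (auto intro: Bochner_Integration.integrable_bound[of _ "\<lambda>x. (f x)\<^sup>2"] simp: max_def)

text \<open>Both sides are bilinear, so splitting into positive and negative parts reduces the claim
  to nonnegative functions: first \<open>g\<close> is split against a nonnegative \<open>f'\<close>,
  then \<open>f\<close> is split against the full \<open>g\<close>.\<close>

lemma L2_inner_kernel_op:
  assumes A: "adjoint_kernels \<mu> \<nu> T S" and f: "f \<in> L2 \<mu>" and g: "g \<in> L2 \<nu>"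
  shows "L2_inner \<mu> f (kernel_op T g) = L2_inner \<nu> (kernel_op S f) g"
proof -
  note B = adjoint_kernels_sym[OF A]
  have neg: "(\<lambda>x. max 0 (- h x)) \<in> L2 \<rho>" if "h \<in> L2 \<rho>" for h :: "'c \<Rightarrow> real" and \<rho>
    using that L2_pos_part[of "\<lambda>x. - h x"] by (simp add: L2_def)
  have split: "h = (\<lambda>x. max 0 (h x) - max 0 (- h x))" for h :: "'c \<Rightarrow> real" by (auto simp: max_def)
  let ?f1 = "\<lambda>x. max 0 (f x)" and ?f2 = "\<lambda>x. max 0 (- f x)"
  let ?g1 = "\<lambda>x. max 0 (g x)" and ?g2 = "\<lambda>x. max 0 (- g x)"
  have F: "?f1 \<in> L2 \<mu>" "?f2 \<in> L2 \<mu>" using f L2_pos_part neg by auto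
  have G: "?g1 \<in> L2 \<nu>" "?g2 \<in> L2 \<nu>" using g L2_pos_part neg by auto
  have *: "L2_inner \<mu> f' (kernel_op T g) = L2_inner \<nu> (kernel_op S f') g"
    if f': "f' \<in> L2 \<mu>" "\<And>x. 0 \<le> f' x" for f'
  proof -
    have "L2_inner \<mu> f' (kernel_op T g) = L2_inner \<mu> f' (kernel_op T ?g1) - L2_inner \<mu> f' (kernel_op T ?g2)"
      using L2_inner_kernel_op_diff[OF A f'(1) G] by (simp flip: split)
    also have "\<dots> = L2_inner \<nu> (kernel_op S f') ?g1 - L2_inner \<nu> (kernel_op S f') ?g2"
      using L2_inner_kernel_op_nonneg[OF A f'(1)] G f'(2) by simp
    also have "\<dots> = L2_inner \<nu> (kernel_op S f') g"
      using L2_inner_diff_left[OF G kernel_op_L2(1)[OF B f'(1)]]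
      by (simp add: L2_inner_commute flip: split)
    finally show ?thesis .
  qed
  have "L2_inner \<mu> f (kernel_op T g) = L2_inner \<mu> ?f1 (kernel_op T g) - L2_inner \<mu> ?f2 (kernel_op T g)"
    using L2_inner_diff_left[OF F kernel_op_L2(1)[OF A g]] by (simp flip: split)
  also have "\<dots> = L2_inner \<nu> g (kernel_op S ?f1) - L2_inner \<nu> g (kernel_op S ?f2)"
    using *[OF F(1)] *[OF F(2)] by (simp add: L2_inner_commute[of \<nu> g])
  also have "\<dots> = L2_inner \<nu> g (kernel_op S f)"
    using L2_inner_kernel_op_diff[OF B g F] by (simp flip: split)
  finally show ?thesis by (simp add: L2_inner_commute)
qed

lemma L2_norm_square: "(L2_norm \<mu> f)\<^sup>2 = (\<integral>x. (f x)\<^sup>2 \<partial>\<mu>)"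
  by (simp add: L2_norm_def)

text \<open>Moving the adjoint across the inner product turns the form of \<open>T\<close> followed
  by its adjoint into a difference of two squared norms, in which the adjoint no longer
  occurs.\<close>

lemma dirichlet_adjoint_kernel:
  assumes A: "adjoint_kernels \<mu> \<mu> T S" and h: "h \<in> L2 \<mu>"
  shows "dirichlet \<mu> (L2_adjoint \<mu> (kernel_op T) \<circ> kernel_op T) h =
    (L2_norm \<mu> h)\<^sup>2 - (L2_norm \<mu> (kernel_op T h))\<^sup>2"
proof -
  let ?P = "\<lambda>S'. \<forall>g\<in>L2 \<mu>. S' g \<in> L2 \<mu> \<and>
     (\<forall>f\<in>L2 \<mu>. L2_inner \<mu> (kernel_op T f) g = L2_inner \<mu> f (S' g))"
  \<comment> \<open>\<open>kernel_op S\<close> witnesses that the choice in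
    \<open>L2_adjoint\<close> has a candidate. Afterwards only the defining property is used, so the
    chosen version is irrelevant.\<close>
  have "?P (kernel_op S)"
    using kernel_op_L2(1)[OF adjoint_kernels_sym[OF A]] L2_inner_kernel_op[OF A]
    by (auto simp: L2_inner_commute)
  then have adj: "?P (L2_adjoint \<mu> (kernel_op T))"
    unfolding L2_adjoint_def by (rule someI[where P="?P"])
  let ?h = "kernel_op T h"
  have Th: "?h \<in> L2 \<mu>" by (rule kernel_op_L2(1)[OF A h])
  have "dirichlet \<mu> (L2_adjoint \<mu> (kernel_op T) \<circ> kernel_op T) h =
    L2_inner \<mu> h h - L2_inner \<mu> (L2_adjoint \<mu> (kernel_op T) ?h) h"
    using adj Th h by (simp add: dirichlet_def L2_inner_diff_left)
  also have "L2_inner \<mu> (L2_adjoint \<mu> (kernel_op T) ?h) h = L2_inner \<mu> ?h ?h"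
    using adj Th h by (simp add: L2_inner_commute)
  finally show ?thesis by (simp only: L2_norm_square L2_inner_def flip: power2_eq_square)
qed

text \<open>Duality with the constant 1, which is square-integrable as \<open>\<mu>\<close> is
  finite and is mapped to 1 by \<open>S\<close>. Hence \<open>kernel_op T\<close> preserves mean
  zero.\<close>

lemma kernel_op_integral:
  assumes A: "adjoint_kernels \<mu> \<nu> T S" and "finite_measure \<mu>" and g: "g \<in> L2 \<nu>"
  shows "(\<integral>x. kernel_op T g x \<partial>\<mu>) = (\<integral>y. g y \<partial>\<nu>)"
proof -
  interpret finite_measure \<mu> by fact
  have S: "S \<in> \<nu> \<rightarrow>\<^sub>M prob_algebra \<mu>" using A by (simp add: adjoint_kernels_def)
  have "L2_inner \<mu> (\<lambda>_. 1) (kernel_op T g) = L2_inner \<nu> (kernel_op S (\<lambda>_. 1)) g"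
    by (rule L2_inner_kernel_op[OF A _ g]) (simp add: L2_def)
  also have "\<dots> = (\<integral>y. g y \<partial>\<nu>)"
    unfolding L2_inner_def
    by (intro Bochner_Integration.integral_cong)
      (auto simp: kernel_op_def prob_space.prob_space[OF kernel_prob(1)[OF S]])
  finally show ?thesis by (simp add: L2_inner_def)
qed

lemma kernel_op_L20:
  assumes "adjoint_kernels \<mu> \<nu> T S" "finite_measure \<mu>" "g \<in> L20 \<nu>"
  shows "kernel_op T g \<in> L20 \<mu>"
  using assms by (simp add: L20_def kernel_op_L2(1) kernel_op_integral)

section \<open>Oscillation\<close>

text \<open>For the forward direction \<open>c\<close> is the essential infimum. This form lets
  later proofs work with real inequalities almost everywhere instead of extended arithmetic.\<close>

lemma osc_le_iff:
  assumes "prob_space M" and f[measurable]: "f \<in> borel_measurable M"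
  shows "osc M f \<le> ereal r \<longleftrightarrow> (\<exists>c. AE x in M. c \<le> f x \<and> f x \<le> c + r)"
proof
  interpret prob_space M by fact
  define d c where "d = esssup M (\<lambda>x. ereal (f x))" and "c = essinf M (\<lambda>x. ereal (f x))"
  have d: "AE x in M. ereal (f x) \<le> d" unfolding d_def by (rule esssup_AE)
  have "AE x in M. - ereal (f x) \<le> - c"
    using esssup_AE[of "\<lambda>x. - ereal (f x)" M] unfolding c_def essinf_def by simp
  then have c: "AE x in M. c \<le> ereal (f x)"
    by eventually_elim (metis ereal_minus_le_minus)
  assume "osc M f \<le> ereal r"
  then have le: "d - c \<le> ereal r" by (simp add: osc_def c_def d_def)
  \<comment> \<open>On a probability space the essential supremum cannot be
    \<open>-\<infinity>\<close> nor the essential infimum \<open>\<infinity>\<close>; with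
    \<open>d - c\<close> bounded above by a real, both are then real.\<close>
  have "d \<noteq> -\<infinity>" using d AE_False by force
  moreover have "c \<noteq> \<infinity>" using c AE_False by force
  ultimately obtain d' c' where dc: "d = ereal d'" "c = ereal c'"
    using le by (cases d; cases c) auto
  have "AE x in M. c' \<le> f x \<and> f x \<le> c' + r"
    using c d by eventually_elim (use le dc in auto)
  then show "\<exists>c. AE x in M. c \<le> f x \<and> f x \<le> c + r" ..
next
  interpret prob_space M by fact
  assume "\<exists>c. AE x in M. c \<le> f x \<and> f x \<le> c + r"
  then obtain c where c: "AE x in M. c \<le> f x \<and> f x \<le> c + r" ..
  have "esssup M (\<lambda>x. ereal (f x)) \<le> ereal (c + r)"
    using c by (intro esssup_I) auto
  moreover have "esssup M (\<lambda>x. - ereal (f x)) \<le> ereal (- c)"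
    using c by (intro esssup_I) auto
  ultimately have "esssup M (\<lambda>x. ereal (f x)) + esssup M (\<lambda>x. - ereal (f x)) \<le> ereal (c + r) + ereal (- c)"
    by (rule add_mono)
  then show "osc M f \<le> ereal r"
    by (simp add: osc_def essinf_def minus_ereal_def)
qed

text \<open>A negative oscillation would confine \<open>f\<close> almost everywhere to an interval
  of negative length \<open>t\<close>.\<close>

lemma osc_nonneg:
  assumes "prob_space M" and f: "f \<in> borel_measurable M"
  shows "0 \<le> osc M f"
proof (rule ccontr)
  interpret prob_space M by fact
  assume "\<not> 0 \<le> osc M f"
  then obtain t where t: "osc M f < ereal t" "ereal t < 0"
    using ereal_dense2[of "osc M f" 0] by (auto simp: not_le)
  then obtain c where "AE x in M. c \<le> f x \<and> f x \<le> c + t"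
    using osc_le_iff[OF assms, of t] by auto
  then have "AE x in M. False" by eventually_elim (use t in auto)
  then show False using AE_False by simp
qed

text \<open>An average of values from an interval stays in that interval, and almost every
  \<open>T x\<close> is concentrated where \<open>f\<close> lies in it.\<close>

lemma osc_kernel_op_le:
  assumes A: "adjoint_kernels \<mu> \<nu> T S" and p: "prob_space \<mu>" "prob_space \<nu>"
    and f: "f \<in> L2 \<nu>" and osc: "osc \<nu> f \<le> ereal r"
  shows "osc \<mu> (kernel_op T f) \<le> ereal r"
proof -
  have T: "T \<in> \<mu> \<rightarrow>\<^sub>M prob_algebra \<nu>" using A by (simp add: adjoint_kernels_def)
  note fm = L2D(1)[OF f]
  obtain c where "AE y in \<nu>. c \<le> f y \<and> f y \<le> c + r"
    using osc by (auto simp: osc_le_iff[OF p(2) fm])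
  from adjoint_kernels_AE[OF A this] kernel_op_L2(3)[OF A f] AE_space
  have "AE x in \<mu>. c \<le> kernel_op T f x \<and> kernel_op T f x \<le> c + r"
  proof eventually_elim
    case (elim x)
    interpret prob_space "T x" using kernel_prob[OF T elim(3)] by simp
    from elim show ?case unfolding kernel_op_def
      by (auto intro!: integral_ge_const integral_le_const L2_integrable)
  qed
  then show ?thesis
    unfolding osc_le_iff[OF p(1) kernel_op_measurable[OF T fm]] by blast
qed

lemma osc_distr_le_iff:
  assumes "prob_space M" and g: "g \<in> M \<rightarrow>\<^sub>M N" and f: "f \<in> borel_measurable N"
  shows "osc (distr M N g) f \<le> ereal r \<longleftrightarrow> osc M (f \<circ> g) \<le> ereal r"
proof -
  have "{x \<in> space N. c \<le> f x \<and> f x \<le> c + r} \<in> sets N" for c using f by measurable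
  then show ?thesis
    using assms by (simp add: osc_le_iff prob_space.prob_space_distr AE_distr_iff comp_def)
qed

text \<open>Popoviciu's inequality, by integrating \<open>0 \<le> (f - c) (c + r - f)\<close>.\<close>

lemma L2_norm_square_le_osc:
  assumes "prob_space M" and f: "f \<in> L20 M" and "osc M f \<le> ereal r"
  shows "(L2_norm M f)\<^sup>2 \<le> r\<^sup>2 / 4"
proof -
  interpret prob_space M by fact
  have L: "f \<in> L2 M" and 0: "(\<integral>x. f x \<partial>M) = 0" using f by (auto simp: L20_def)
  note [simp] = L2D(2)[OF L] L2_integrable[OF L]
  obtain c where c: "AE x in M. c \<le> f x \<and> f x \<le> c + r"
    using assms(3) by (auto simp: osc_le_iff[OF assms(1) L2D(1)[OF L]])
  from c have "AE x in M. 0 \<le> (f x - c) * (c + r - f x)"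
    by eventually_elim simp
  then have "0 \<le> (\<integral>x. (f x - c) * (c + r - f x) \<partial>M)"
    by (rule integral_nonneg_AE)
  also have "(\<lambda>x. (f x - c) * (c + r - f x)) = (\<lambda>x. (2 * c + r) * f x - (f x)\<^sup>2 - c * (c + r))"
    by (auto simp: algebra_simps power2_eq_square)
  also have "(\<integral>x. (2 * c + r) * f x - (f x)\<^sup>2 - c * (c + r) \<partial>M) = - (\<integral>x. (f x)\<^sup>2 \<partial>M) - c * (c + r)"
    by (simp add: 0 prob_space)
  \<comment> \<open>The mean-zero condition has removed the linear term; completing the square
    rewrites \<open>- c * (c + r)\<close>.\<close>
  finally have "(\<integral>x. (f x)\<^sup>2 \<partial>M) \<le> r\<^sup>2 / 4 - (c + r / 2)\<^sup>2"
    by (simp add: power2_eq_square field_simps)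
  then show ?thesis unfolding L2_norm_square using zero_le_power2[of "c + r / 2"] by linarith
qed

section \<open>The rate function of a weak Poincare inequality\<close>

lemma wpi_Kstar_ge: "0 \<le> u \<Longrightarrow> ereal (u * v - wpi_K \<beta> u) \<le> wpi_Kstar \<beta> v"
  unfolding wpi_Kstar_def by (auto intro: SUP_upper)

lemma wpi_Kstar_mono: "v \<le> w \<Longrightarrow> wpi_Kstar \<beta> v \<le> wpi_Kstar \<beta> w"
  unfolding wpi_Kstar_def
  by (intro SUP_mono) (auto intro!: bexI diff_mono mult_left_mono)

text \<open>The decay of \<open>\<beta>\<close> supplies an \<open>s\<close> with
  \<open>\<beta> s < v\<close>, and the test point \<open>u = 1 / s\<close> contributes
  \<open>(v - \<beta> s) / s\<close> to the supremum.\<close>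

lemma wpi_Kstar_pos:
  assumes "(\<beta> \<longlongrightarrow> 0) at_top" and "0 < v"
  shows "0 < wpi_Kstar \<beta> v"
proof -
  have "eventually (\<lambda>s. \<beta> s < v) at_top"
    using assms by (rule order_tendstoD(2))
  then obtain s where s: "0 < s" "\<beta> s < v"
    using eventually_happens[OF eventually_conj[OF eventually_gt_at_top[of 0]]] by auto
  then have "0 < 1 / s * v - wpi_K \<beta> (1 / s)"
    by (simp add: wpi_K_def field_simps)
  then have "0 < ereal (1 / s * v - wpi_K \<beta> (1 / s))" by simp
  also have "\<dots> \<le> wpi_Kstar \<beta> v" using s by (intro wpi_Kstar_ge) auto
  finally show ?thesis .
qed

text \<open>With \<open>u = 1 / s\<close>, dividing the assumption by \<open>s\<close> gives
  \<open>u * v - wpi_K \<beta> u \<le> e\<close>; the remaining point \<open>u = 0\<close> only asks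
  for \<open>0 \<le> e\<close>. This is the optimisation over \<open>s\<close> in the weak Poincare
  inequality.\<close>

lemma wpi_Kstar_le:
  assumes "0 \<le> e" and "\<And>s. 0 < s \<Longrightarrow> v \<le> s * e + \<beta> s"
  shows "wpi_Kstar \<beta> v \<le> ereal e"
  unfolding wpi_Kstar_def
proof (rule SUP_least)
  fix u :: real assume "u \<in> {0..}"
  then consider "u = 0" | "0 < u" by fastforce
  then show "ereal (u * v - wpi_K \<beta> u) \<le> ereal e"
  proof cases
    case 2
    with assms(2)[of "1 / u"] show ?thesis
      by (simp add: wpi_K_def field_simps)
  qed (use assms in \<open>simp add: wpi_K_def\<close>)
qed

section \<open>The function \<open>F\<close> and its inverse\<close>

locale wpi_rate =
  fixes \<beta> :: "real \<Rightarrow> real"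
  assumes lim: "(\<beta> \<longlongrightarrow> 0) at_top"
    and Kstar_le: "\<forall>v\<in>{0..1/4}. wpi_Kstar \<beta> v \<le> ereal v"
begin

abbreviation k :: "real \<Rightarrow> real" where "k v \<equiv> real_of_ereal (wpi_Kstar \<beta> v)"

text \<open>Positivity excludes \<open>-\<infinity>\<close> and the normalisation excludes
  \<open>\<infinity>\<close>, so the real-valued \<open>k\<close> loses nothing on this
  range.\<close>

lemma Kstar_real:
  assumes "0 < v" "v \<le> 1/4" shows "wpi_Kstar \<beta> v = ereal (k v)"
  using wpi_Kstar_pos[OF lim assms(1)] Kstar_le[rule_format, of v] assms
  by (cases "wpi_Kstar \<beta> v") auto

lemma k_pos: "0 < v \<Longrightarrow> v \<le> 1/4 \<Longrightarrow> 0 < k v"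
  using wpi_Kstar_pos[OF lim, of v] Kstar_real[of v] by (metis ereal_less(2))

lemma k_le: "0 < v \<Longrightarrow> v \<le> 1/4 \<Longrightarrow> k v \<le> v"
  using Kstar_le Kstar_real[of v] by (metis atLeastAtMost_iff ereal_less_eq(3) less_imp_le)

lemma k_mono: "0 < v \<Longrightarrow> v \<le> w \<Longrightarrow> w \<le> 1/4 \<Longrightarrow> k v \<le> k w"
  using wpi_Kstar_mono[of v w \<beta>] Kstar_real[of v] Kstar_real[of w]
  by (metis ereal_less_eq(3) order_trans less_le_trans)

text \<open>A monotone function on a compact interval is integrable; the sign change turns the
  decreasing \<open>1 / k\<close> into an increasing function.\<close>

lemma inverse_k_integrable:
  assumes "0 < x" "y \<le> 1/4"
  shows "(\<lambda>v. 1 / k v) integrable_on {x..y}"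
proof -
  have "mono_on {x..y} (\<lambda>v. - (1 / k v))"
    using assms by (auto intro!: mono_onI divide_left_mono k_mono mult_pos_pos k_pos)
  then have "(\<lambda>v. - (1 / k v)) integrable_on {x..y}"
    by (rule integrable_on_mono_on)
  then show ?thesis using integrable_neg by fastforce
qed

lemma F_diff:
  assumes "0 < x" "x \<le> y" "y \<le> 1/4"
  shows "wpi_F \<beta> x = wpi_F \<beta> y + integral {x..y} (\<lambda>v. 1 / k v)"
  unfolding wpi_F_def
  using Henstock_Kurzweil_Integration.integral_combine[of x y "1/4" "\<lambda>v. 1 / k v"]
    inverse_k_integrable[of x "1/4"] assms by simp

lemma F_diff_ge:
  assumes "0 < x" "x \<le> y" "y \<le> 1/4"
  shows "wpi_F \<beta> y + (y - x) / k y \<le> wpi_F \<beta> x"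
proof -
  have "integral {x..y} (\<lambda>_. 1 / k y) \<le> integral {x..y} (\<lambda>v. 1 / k v)"
    using assms by (intro integral_le inverse_k_integrable)
      (auto intro!: divide_left_mono k_mono mult_pos_pos k_pos)
  then show ?thesis using F_diff[OF assms] assms by simp
qed

lemma F_strict_antimono:
  assumes "0 < x" "x < y" "y \<le> 1/4"
  shows "wpi_F \<beta> y < wpi_F \<beta> x"
  using F_diff_ge[of x y] assms k_pos[of y] divide_pos_pos[of "y - x" "k y"] by linarith

lemma F_inj: "inj_on (wpi_F \<beta>) {0<..1/4}"
  by (rule linorder_inj_onI') (use F_strict_antimono in fastforce)

text \<open>The normalisation gives \<open>1 / k v \<ge> 1 / v\<close>, whose integral is the
  logarithm. Hence \<open>F\<close> is unbounded near 0, which makes its inverse meaningful at every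
  \<open>t \<ge> 0\<close>.\<close>

lemma F_ge_ln:
  assumes "0 < x" "x \<le> 1/4"
  shows "- ln (4 * x) \<le> wpi_F \<beta> x"
proof -
  have "((\<lambda>v. 1 / v) has_integral (ln (1/4) - ln x)) {x..1/4}"
    using assms by (intro fundamental_theorem_of_calculus)
      (auto intro!: derivative_eq_intros simp flip: has_real_derivative_iff_has_vector_derivative)
  then have "ln (1/4) - ln x \<le> wpi_F \<beta> x"
    unfolding wpi_F_def
    using integrable_integral[OF inverse_k_integrable[of x "1/4"]] assms
    by (elim has_integral_le) (auto intro!: divide_left_mono k_le mult_pos_pos k_pos)
  then show ?thesis using assms by (simp add: ln_mult ln_div)
qed

lemma F_continuous:
  assumes "0 < x"
  shows "continuous_on {x..1/4} (wpi_F \<beta>)"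
  unfolding wpi_F_def
  using indefinite_integral_continuous_1'[OF inverse_k_integrable[of x "1/4"]] assms by simp

lemma F_surj:
  assumes "0 \<le> t"
  shows "t \<in> wpi_F \<beta> ` {0<..1/4}"
proof -
  \<comment> \<open>Chosen so that the logarithmic lower bound for \<open>F\<close> at
    \<open>x\<close> is exactly \<open>t\<close>; the intermediate value theorem then applies
    between \<open>x\<close> and \<open>1/4\<close>, where \<open>F\<close> vanishes.\<close>
  define x where "x = exp (- t) / 4"
  have x: "0 < x" "x \<le> 1/4" using assms by (auto simp: x_def)
  have "t \<le> wpi_F \<beta> x" using F_ge_ln[OF x] by (simp add: x_def)
  moreover have "wpi_F \<beta> (1/4) = 0" by (simp add: wpi_F_def)
  ultimately obtain y where "x \<le> y" "y \<le> 1/4" "wpi_F \<beta> y = t"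
    using IVT2'[of "wpi_F \<beta>" "1/4" t x] F_continuous[OF x(1)] x assms by auto
  then show ?thesis using x by force
qed

text \<open>\<open>F\<close> strictly decreases and surjectivity ensures that
  \<open>the_inv_into\<close> returns a true preimage. The bound on \<open>F\<close> is asked for
  positive \<open>v\<close> only, because the inverse is positive and so dominates every
  \<open>v \<le> 0\<close>.\<close>

lemma le_F_inv:
  assumes t: "0 \<le> t" and v: "v \<le> 1/4" "0 < v \<Longrightarrow> t \<le> wpi_F \<beta> v"
  shows "v \<le> wpi_F_inv \<beta> t"
proof -
  let ?y = "wpi_F_inv \<beta> t"
  have y: "?y \<in> {0<..1/4}" "wpi_F \<beta> ?y = t"
    unfolding wpi_F_inv_def
    using the_inv_into_into[OF F_inj F_surj[OF t] subset_refl] f_the_inv_into_f[OF F_inj F_surj[OF t]] by auto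
  show ?thesis
  proof (rule ccontr)
    assume "\<not> v \<le> ?y"
    then show False using F_strict_antimono[of ?y v] y v by simp
  qed
qed

text \<open>Discrete comparison with the differential equation \<open>v' = - K\<^sup>*(v)\<close>: as \<open>1 / K\<^sup>*\<close> is
  decreasing, the integral over \<open>[v (Suc n), v n]\<close> of \<open>1 / K\<^sup>*\<close> is at least \<open>(v n - v (Suc n)) / K\<^sup>*(v n) \<ge> 1\<close>.\<close>

lemma le_F_inv_of_recurrence:
  fixes v :: "nat \<Rightarrow> real"
  assumes "v 0 \<le> 1/4" and step: "\<And>n. wpi_Kstar \<beta> (v n) \<le> ereal (v n - v (Suc n))"
  shows "v n \<le> wpi_F_inv \<beta> (real n)"
proof -
  have dec: "v (Suc n) \<le> v n" for n
    \<comment> \<open>The test point \<open>u = 0\<close> shows that \<open>wpi_Kstar\<close> is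
      nonnegative, so the recurrence forces \<open>v\<close> to decrease.\<close>
    using order_trans[OF wpi_Kstar_ge[of 0 "v n" \<beta>] step] by (simp add: wpi_K_def)
  have le: "v n \<le> 1/4" for n
    by (induction n) (use assms(1) dec order_trans in blast)+
  have "real n \<le> wpi_F \<beta> (v n)" if "0 < v n" for n
    using that
  proof (induction n)
    case 0
    have "0 \<le> (1/4 - v 0) / k (1/4)" using le[of 0] k_pos[of "1/4"] by simp
    moreover have "wpi_F \<beta> (1/4) = 0" by (simp add: wpi_F_def)
    ultimately show ?case using F_diff_ge[of "v 0" "1/4"] 0 le[of 0] by simp
  next
    case (Suc n)
    then have pos: "0 < v n" using dec[of n] by simp
    have "ereal (k (v n)) \<le> ereal (v n - v (Suc n))"
      using step[of n] by (subst (asm) Kstar_real[OF pos le])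
    then have "1 \<le> (v n - v (Suc n)) / k (v n)"
      using k_pos[OF pos le] by simp
    then show ?case
      using Suc.IH[OF pos] F_diff_ge[OF Suc.prems dec le] by simp
  qed
  then show ?thesis using le by (intro le_F_inv) auto
qed

end

section \<open>The two-component Gibbs sampler\<close>

lemma prob_algebra_cong: "sets M = sets N \<Longrightarrow> prob_algebra M = prob_algebra N"
  by (simp add: prob_algebra_def cong: subprob_algebra_cong)

text \<open>\<open>regular_conditional\<close> states agreement on measurable rectangles, which form
  an intersection-stable generator, and the joint law is finite.\<close>

lemma distr_pair_regular_conditional:
  fixes U :: "'a \<Rightarrow> 'u::topological_space" and V :: "'a \<Rightarrow> 'v::topological_space"
  assumes "prob_space \<pi>" and U[measurable]: "U \<in> \<pi> \<rightarrow>\<^sub>M borel" and V[measurable]: "V \<in> \<pi> \<rightarrow>\<^sub>M borel"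
    and rc: "regular_conditional \<pi> U V \<kappa>"
  shows "distr \<pi> (borel \<Otimes>\<^sub>M borel) (\<lambda>\<omega>. (U \<omega>, V \<omega>)) =
    distr \<pi> borel U \<bind> (\<lambda>u. \<kappa> u \<bind> (\<lambda>v. return (borel \<Otimes>\<^sub>M borel) (u, v)))" (is "?L = ?R")
proof -
  interpret prob_space \<pi> by fact
  interpret D: prob_space "distr \<pi> borel U" by (rule prob_space_distr) (rule U)
  let ?B = "(borel :: 'u measure) \<Otimes>\<^sub>M (borel :: 'v measure)"
  have \<kappa>[measurable]: "\<kappa> \<in> borel \<rightarrow>\<^sub>M prob_algebra borel"
    using rc by (simp add: regular_conditional_def)
  have k: "(\<lambda>u. \<kappa> u \<bind> (\<lambda>v. return ?B (u, v))) \<in> distr \<pi> borel U \<rightarrow>\<^sub>M prob_algebra ?B"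
    by simp measurable
  have sR: "sets ?R = sets ?B"
    using sets_bind_measurable[OF measurable_prob_algebraD[OF k]] by simp
  show ?thesis
  proof (rule measure_eqI_generator_eq[where \<Omega>=UNIV and A="\<lambda>_. UNIV"
        and E="{A \<times> B | A B. A \<in> sets borel \<and> B \<in> sets borel}"])
    show "Int_stable {A \<times> B |A B. A \<in> sets (borel :: 'u measure) \<and> B \<in> sets (borel :: 'v measure)}"
      by (rule Int_stable_pair_measure_generator)
    show "sets ?L = sigma_sets UNIV {A \<times> B |A B. A \<in> sets borel \<and> B \<in> sets borel}"
      by (simp add: sets_pair_measure)
    show "sets ?R = sigma_sets UNIV {A \<times> B |A B. A \<in> sets borel \<and> B \<in> sets borel}"
      using sR by (simp add: sets_pair_measure)
    show "range (\<lambda>_. UNIV) \<subseteq> {A \<times> B |A B. A \<in> sets (borel :: 'u measure) \<and> B \<in> sets (borel :: 'v measure)}"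
      by (auto intro!: exI[of _ UNIV])
    show "emeasure ?L UNIV \<noteq> \<infinity>"
      using prob_space.emeasure_space_1[OF prob_space_distr, of "\<lambda>\<omega>. (U \<omega>, V \<omega>)" ?B]
      by (simp add: space_pair_measure)
    fix X :: "('u \<times> 'v) set" assume "X \<in> {A \<times> B |A B. A \<in> sets borel \<and> B \<in> sets borel}"
    then obtain A B where X: "X = A \<times> B" and [measurable]: "A \<in> sets borel" "B \<in> sets borel"
      by auto
    have *: "emeasure (\<kappa> u \<bind> (\<lambda>v. return ?B (u, v))) X = emeasure (\<kappa> u) B * indicator A u" for u
    proof -
      have su: "sets (\<kappa> u) = sets borel" "prob_space (\<kappa> u)"
        using kernel_prob[OF \<kappa>, of u] by auto
      interpret ku: prob_space "\<kappa> u" by fact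
      have mr: "(\<lambda>v. return ?B (u, v)) \<in> \<kappa> u \<rightarrow>\<^sub>M subprob_algebra ?B"
        by (subst measurable_cong_sets[OF su(1) refl]) measurable
      have "emeasure (\<kappa> u \<bind> (\<lambda>v. return ?B (u, v))) X = (\<integral>\<^sup>+v. emeasure (return ?B (u, v)) X \<partial>\<kappa> u)"
        using mr by (intro emeasure_bind[OF ku.not_empty]) (auto simp: X)
      also have "\<dots> = (\<integral>\<^sup>+v. indicator A u * indicator B v \<partial>\<kappa> u)"
        by (intro nn_integral_cong) (auto simp: X split: split_indicator)
      also have "\<dots> = emeasure (\<kappa> u) B * indicator A u"
        using su by (simp add: nn_integral_cmult mult.commute)
      finally show ?thesis .
    qed
    have "emeasure ?R X = (\<integral>\<^sup>+u. emeasure (\<kappa> u \<bind> (\<lambda>v. return ?B (u, v))) X \<partial>distr \<pi> borel U)"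
      using D.not_empty by (intro emeasure_bind[OF _ measurable_prob_algebraD[OF k]]) (auto simp: X)
    also have "\<dots> = emeasure \<pi> {\<omega> \<in> space \<pi>. U \<omega> \<in> A \<and> V \<omega> \<in> B}"
      unfolding * using rc by (simp add: regular_conditional_def)
    also have "\<dots> = emeasure ?L X"
      by (subst emeasure_distr) (auto simp: X intro!: arg_cong[where f="emeasure \<pi>"])
    finally show "emeasure ?L X = emeasure ?R X" by simp
  qed auto
qed

text \<open>Writing the joint law as a \<open>bind\<close> extends the identity from rectangles to
  all nonnegative measurable functions.\<close>

lemma nn_integral_regular_conditional:
  fixes U :: "'a \<Rightarrow> 'u::topological_space" and V :: "'a \<Rightarrow> 'v::topological_space"
  assumes "prob_space \<pi>" and U[measurable]: "U \<in> \<pi> \<rightarrow>\<^sub>M borel" and V[measurable]: "V \<in> \<pi> \<rightarrow>\<^sub>M borel"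
    and rc: "regular_conditional \<pi> U V \<kappa>"
    and \<phi>[measurable]: "\<phi> \<in> borel_measurable (borel \<Otimes>\<^sub>M borel)"
  shows "(\<integral>\<^sup>+\<omega>. \<phi> (U \<omega>, V \<omega>) \<partial>\<pi>) = (\<integral>\<^sup>+u. \<integral>\<^sup>+v. \<phi> (u, v) \<partial>\<kappa> u \<partial>distr \<pi> borel U)"
proof -
  let ?B = "(borel :: 'u measure) \<Otimes>\<^sub>M (borel :: 'v measure)"
  have \<kappa>[measurable]: "\<kappa> \<in> borel \<rightarrow>\<^sub>M prob_algebra borel"
    using rc by (simp add: regular_conditional_def)
  have k: "(\<lambda>u. \<kappa> u \<bind> (\<lambda>v. return ?B (u, v))) \<in> distr \<pi> borel U \<rightarrow>\<^sub>M subprob_algebra ?B"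
    by (simp, rule measurable_prob_algebraD) measurable
  have "(\<integral>\<^sup>+\<omega>. \<phi> (U \<omega>, V \<omega>) \<partial>\<pi>) = (\<integral>\<^sup>+z. \<phi> z \<partial>distr \<pi> ?B (\<lambda>\<omega>. (U \<omega>, V \<omega>)))"
    by (subst nn_integral_distr) auto
  also have "\<dots> = (\<integral>\<^sup>+u. \<integral>\<^sup>+z. \<phi> z \<partial>(\<kappa> u \<bind> (\<lambda>v. return ?B (u, v))) \<partial>distr \<pi> borel U)"
    unfolding distr_pair_regular_conditional[OF assms(1-4)]
    by (rule nn_integral_bind[OF \<phi> k])
  also have "\<dots> = (\<integral>\<^sup>+u. \<integral>\<^sup>+v. \<phi> (u, v) \<partial>\<kappa> u \<partial>distr \<pi> borel U)"
  proof (intro nn_integral_cong)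
    fix u
    have su: "sets (\<kappa> u) = sets borel" using kernel_prob[OF \<kappa>, of u] by simp
    have mr: "(\<lambda>v. return ?B (u, v)) \<in> \<kappa> u \<rightarrow>\<^sub>M subprob_algebra ?B"
      by (subst measurable_cong_sets[OF su refl]) measurable
    show "(\<integral>\<^sup>+z. \<phi> z \<partial>(\<kappa> u \<bind> (\<lambda>v. return ?B (u, v)))) = (\<integral>\<^sup>+v. \<phi> (u, v) \<partial>\<kappa> u)"
      by (subst nn_integral_bind[OF \<phi> mr], intro nn_integral_cong nn_integral_return)
        (auto simp: space_pair_measure)
  qed
  finally show ?thesis .
qed

section \<open>The Gibbs kernels and their adjoints\<close>

locale two_component_gibbs =
  fixes \<pi> :: "('x::second_countable_topology \<times> 'y::second_countable_topology) measure"
    and \<kappa>Y :: "'x \<Rightarrow> 'y measure" and \<kappa>X :: "'y \<Rightarrow> 'x measure"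
  assumes prob: "prob_space \<pi>" and sets_\<pi>: "sets \<pi> = sets borel"
    and rcY: "regular_conditional \<pi> fst snd \<kappa>Y"
    and rcX: "regular_conditional \<pi> snd fst \<kappa>X"
begin

abbreviation "\<pi>X \<equiv> distr \<pi> borel fst"
abbreviation "\<pi>Y \<equiv> distr \<pi> borel snd"
abbreviation "P \<equiv> kernel_op (gibbs_kernel \<kappa>Y \<kappa>X)"
abbreviation "PX \<equiv> kernel_op (marginal_kernel \<kappa>Y \<kappa>X)"

text \<open>The kernels refreshing one coordinate and keeping the other; as operators they are the
  conditional expectations given the coordinate that is kept.\<close>

definition refresh_Y :: "'x \<times> 'y \<Rightarrow> ('x \<times> 'y) measure" where
  "refresh_Y = (\<lambda>(x, y). \<kappa>Y x \<bind> (\<lambda>y'. return borel (x, y')))"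

definition refresh_X :: "'x \<times> 'y \<Rightarrow> ('x \<times> 'y) measure" where
  "refresh_X = (\<lambda>(x, y). \<kappa>X y \<bind> (\<lambda>x'. return borel (x', y)))"

lemma measurable_\<kappa> [measurable]:
  "\<kappa>Y \<in> borel \<rightarrow>\<^sub>M prob_algebra borel" "\<kappa>X \<in> borel \<rightarrow>\<^sub>M prob_algebra borel"
  using rcX rcY by (auto simp: regular_conditional_def)

lemma measurable_\<pi> [measurable]: "fst \<in> \<pi> \<rightarrow>\<^sub>M borel" "snd \<in> \<pi> \<rightarrow>\<^sub>M borel"
proof -
  \<comment> \<open>Second countability enters through \<open>borel_prod\<close>, which identifies
    the Borel sets of the product space with the product sigma-algebra.\<close>
  have "fst \<in> (borel \<Otimes>\<^sub>M borel :: ('x \<times> 'y) measure) \<rightarrow>\<^sub>M borel"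
    "snd \<in> (borel \<Otimes>\<^sub>M borel :: ('x \<times> 'y) measure) \<rightarrow>\<^sub>M borel"
    by measurable
  then show "fst \<in> \<pi> \<rightarrow>\<^sub>M borel" "snd \<in> \<pi> \<rightarrow>\<^sub>M borel"
    by (simp_all add: measurable_cong_sets[OF sets_\<pi> refl] borel_prod)
qed

lemma prob_marginals: "prob_space \<pi>X" "prob_space \<pi>Y"
  using prob by (auto intro!: prob_space.prob_space_distr)

lemma nn_integral_disintegration:
  assumes "\<phi> \<in> borel_measurable borel"
  shows "(\<integral>\<^sup>+z. \<phi> z \<partial>\<pi>) = (\<integral>\<^sup>+x. \<integral>\<^sup>+y. \<phi> (x, y) \<partial>\<kappa>Y x \<partial>\<pi>X)"
    and "(\<integral>\<^sup>+z. \<phi> z \<partial>\<pi>) = (\<integral>\<^sup>+y. \<integral>\<^sup>+x. \<phi> (x, y) \<partial>\<kappa>X y \<partial>\<pi>Y)"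
proof -
  have [measurable]: "\<phi> \<in> borel_measurable (borel \<Otimes>\<^sub>M borel)"
    using assms by (simp add: borel_prod)
  show "(\<integral>\<^sup>+z. \<phi> z \<partial>\<pi>) = (\<integral>\<^sup>+x. \<integral>\<^sup>+y. \<phi> (x, y) \<partial>\<kappa>Y x \<partial>\<pi>X)"
    using nn_integral_regular_conditional[OF prob measurable_\<pi> rcY, of \<phi>] by simp
  show "(\<integral>\<^sup>+z. \<phi> z \<partial>\<pi>) = (\<integral>\<^sup>+y. \<integral>\<^sup>+x. \<phi> (x, y) \<partial>\<kappa>X y \<partial>\<pi>Y)"
    using nn_integral_regular_conditional[OF prob measurable_\<pi>(2,1) rcX, of "\<lambda>(y, x). \<phi> (x, y)"]
    by simp
qed

text \<open>Both sides are the integral of \<open>a x * b y\<close> under the joint law,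
  disintegrated in the two possible orders.\<close>

lemma adjoint_conditionals: "adjoint_kernels \<pi>X \<pi>Y \<kappa>Y \<kappa>X"
  unfolding adjoint_kernels_def
proof (intro conjI ballI)
  show "\<kappa>Y \<in> \<pi>X \<rightarrow>\<^sub>M prob_algebra \<pi>Y" "\<kappa>X \<in> \<pi>Y \<rightarrow>\<^sub>M prob_algebra \<pi>X"
    by (simp_all cong: prob_algebra_cong)
  fix a :: "'x \<Rightarrow> ennreal" and b :: "'y \<Rightarrow> ennreal"
  assume "a \<in> borel_measurable \<pi>X" "b \<in> borel_measurable \<pi>Y"
  then have [measurable]: "a \<in> borel_measurable borel" "b \<in> borel_measurable borel" by auto
  have m: "(\<lambda>z. a (fst z) * b (snd z)) \<in> borel_measurable borel"
    unfolding borel_prod[symmetric] by measurable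
  have "(\<integral>\<^sup>+x. a x * (\<integral>\<^sup>+y. b y \<partial>\<kappa>Y x) \<partial>\<pi>X) = (\<integral>\<^sup>+x. \<integral>\<^sup>+y. a x * b y \<partial>\<kappa>Y x \<partial>\<pi>X)"
    using kernel_prob[OF measurable_\<kappa>(1)]
    by (intro nn_integral_cong nn_integral_cmult[symmetric]) (simp cong: measurable_cong_sets)
  also have "\<dots> = (\<integral>\<^sup>+y. \<integral>\<^sup>+x. a x * b y \<partial>\<kappa>X y \<partial>\<pi>Y)"
    using nn_integral_disintegration[OF m] by simp
  also have "\<dots> = (\<integral>\<^sup>+y. (\<integral>\<^sup>+x. a x \<partial>\<kappa>X y) * b y \<partial>\<pi>Y)"
    using kernel_prob[OF measurable_\<kappa>(2)]
    by (intro nn_integral_cong nn_integral_multc) (simp cong: measurable_cong_sets)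
  finally show "(\<integral>\<^sup>+x. a x * (\<integral>\<^sup>+y. b y \<partial>\<kappa>Y x) \<partial>\<pi>X) = (\<integral>\<^sup>+y. (\<integral>\<^sup>+x. a x \<partial>\<kappa>X y) * b y \<partial>\<pi>Y)" .
qed

lemma measurable_refresh [measurable]:
  "refresh_Y \<in> borel \<rightarrow>\<^sub>M prob_algebra borel" "refresh_X \<in> borel \<rightarrow>\<^sub>M prob_algebra borel"
  unfolding refresh_X_def refresh_Y_def borel_prod[symmetric] by measurable

lemma nn_integral_refresh:
  assumes "b \<in> borel_measurable borel"
  shows "(\<integral>\<^sup>+z. b z \<partial>refresh_Y (x, y)) = (\<integral>\<^sup>+y'. b (x, y') \<partial>\<kappa>Y x)"
    and "(\<integral>\<^sup>+z. b z \<partial>refresh_X (x, y)) = (\<integral>\<^sup>+x'. b (x', y) \<partial>\<kappa>X y)"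
proof -
  have b[measurable]: "b \<in> borel_measurable (borel \<Otimes>\<^sub>M borel)" using assms by (simp add: borel_prod)
  have 1: "(\<lambda>y'. return (borel \<Otimes>\<^sub>M borel) (x, y')) \<in> \<kappa>Y x \<rightarrow>\<^sub>M subprob_algebra (borel \<Otimes>\<^sub>M borel)"
    by (subst measurable_cong_sets[OF kernel_prob(2)[OF measurable_\<kappa>(1)] refl]) auto
  show "(\<integral>\<^sup>+z. b z \<partial>refresh_Y (x, y)) = (\<integral>\<^sup>+y'. b (x, y') \<partial>\<kappa>Y x)"
    unfolding refresh_Y_def prod.case borel_prod[symmetric]
    by (subst nn_integral_bind[OF b 1], intro nn_integral_cong nn_integral_return)
      (auto simp: space_pair_measure)
  have 2: "(\<lambda>x'. return (borel \<Otimes>\<^sub>M borel) (x', y)) \<in> \<kappa>X y \<rightarrow>\<^sub>M subprob_algebra (borel \<Otimes>\<^sub>M borel)"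
    by (subst measurable_cong_sets[OF kernel_prob(2)[OF measurable_\<kappa>(2)] refl]) auto
  show "(\<integral>\<^sup>+z. b z \<partial>refresh_X (x, y)) = (\<integral>\<^sup>+x'. b (x', y) \<partial>\<kappa>X y)"
    unfolding refresh_X_def prod.case borel_prod[symmetric]
    by (subst nn_integral_bind[OF b 2], intro nn_integral_cong nn_integral_return)
      (auto simp: space_pair_measure)
qed

lemma borel_sections:
  fixes b :: "'x \<times> 'y \<Rightarrow> ennreal"
  assumes "b \<in> borel_measurable borel"
  shows "(\<lambda>y. b (x, y)) \<in> borel_measurable (\<kappa>Y x)" "(\<lambda>x. b (x, y)) \<in> borel_measurable (\<kappa>X y)"
proof -
  have [measurable]: "b \<in> borel_measurable (borel \<Otimes>\<^sub>M borel)" using assms by (simp add: borel_prod)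
  show "(\<lambda>y. b (x, y)) \<in> borel_measurable (\<kappa>Y x)" "(\<lambda>x. b (x, y)) \<in> borel_measurable (\<kappa>X y)"
    using kernel_prob(2)[OF measurable_\<kappa>(1), of x] kernel_prob(2)[OF measurable_\<kappa>(2), of y]
    by (simp_all cong: measurable_cong_sets)
qed

text \<open>Disintegrating along the kept coordinate turns both sides into the integral of a product
  of two conditional integrals, an expression in which \<open>a\<close> and \<open>b\<close> play
  the same part.\<close>

lemma adjoint_refresh:
  "adjoint_kernels \<pi> \<pi> refresh_Y refresh_Y" "adjoint_kernels \<pi> \<pi> refresh_X refresh_X"
proof -
  have pa: "prob_algebra \<pi> = prob_algebra borel" using sets_\<pi> by (rule prob_algebra_cong)
  have mY: "refresh_Y \<in> \<pi> \<rightarrow>\<^sub>M prob_algebra \<pi>" and mX: "refresh_X \<in> \<pi> \<rightarrow>\<^sub>M prob_algebra \<pi>"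
    using measurable_refresh by (simp_all add: pa measurable_cong_sets[OF sets_\<pi> refl])
  have "(\<integral>\<^sup>+z. a z * (\<integral>\<^sup>+w. b w \<partial>refresh_Y z) \<partial>\<pi>) = (\<integral>\<^sup>+z. (\<integral>\<^sup>+w. a w \<partial>refresh_Y z) * b z \<partial>\<pi>)"
    "(\<integral>\<^sup>+z. a z * (\<integral>\<^sup>+w. b w \<partial>refresh_X z) \<partial>\<pi>) = (\<integral>\<^sup>+z. (\<integral>\<^sup>+w. a w \<partial>refresh_X z) * b z \<partial>\<pi>)"
    if "a \<in> borel_measurable \<pi>" "b \<in> borel_measurable \<pi>" for a b :: "'x \<times> 'y \<Rightarrow> ennreal"
  proof -
    have a: "a \<in> borel_measurable borel" and b: "b \<in> borel_measurable borel"
      using that by (simp_all add: measurable_cong_sets[OF sets_\<pi> refl])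
    note m = borel_measurable_nn_integral_kernel[OF measurable_refresh(1)]
      borel_measurable_nn_integral_kernel[OF measurable_refresh(2)]
    show "(\<integral>\<^sup>+z. a z * (\<integral>\<^sup>+w. b w \<partial>refresh_Y z) \<partial>\<pi>) = (\<integral>\<^sup>+z. (\<integral>\<^sup>+w. a w \<partial>refresh_Y z) * b z \<partial>\<pi>)"
      using a b m by (simp add: nn_integral_disintegration(1) nn_integral_refresh
          nn_integral_multc nn_integral_cmult borel_sections)
    show "(\<integral>\<^sup>+z. a z * (\<integral>\<^sup>+w. b w \<partial>refresh_X z) \<partial>\<pi>) = (\<integral>\<^sup>+z. (\<integral>\<^sup>+w. a w \<partial>refresh_X z) * b z \<partial>\<pi>)"
      using a b m by (simp add: nn_integral_disintegration(2) nn_integral_refresh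
          nn_integral_multc nn_integral_cmult borel_sections)
  qed
  then show "adjoint_kernels \<pi> \<pi> refresh_Y refresh_Y" "adjoint_kernels \<pi> \<pi> refresh_X refresh_X"
    using mX mY by (auto simp: adjoint_kernels_def)
qed

text \<open>\<open>refresh_X\<close> forgets the \<open>x\<close> that \<open>refresh_Y\<close>
  carries along. The factorisation into two self-adjoint kernels yields the adjoint of the Gibbs
  kernel as the scan in opposite order.\<close>

lemma gibbs_kernel_eq: "gibbs_kernel \<kappa>Y \<kappa>X = (\<lambda>z. refresh_Y z \<bind> refresh_X)"
proof (intro ext, clarify)
  fix x :: 'x and y :: 'y
  have [measurable]: "refresh_X \<in> borel \<Otimes>\<^sub>M borel \<rightarrow>\<^sub>M prob_algebra (borel \<Otimes>\<^sub>M borel)"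
    using measurable_refresh(2) by (simp add: borel_prod)
  have sY: "sets (\<kappa>Y x) = sets borel" using kernel_prob(2)[OF measurable_\<kappa>(1)] by simp
  have "(\<lambda>y'. return (borel \<Otimes>\<^sub>M borel) (x, y')) \<in> \<kappa>Y x \<rightarrow>\<^sub>M subprob_algebra (borel \<Otimes>\<^sub>M borel)"
    by (subst measurable_cong_sets[OF sY refl]) auto
  then have "refresh_Y (x, y) \<bind> refresh_X = \<kappa>Y x \<bind> (\<lambda>y'. return borel (x, y') \<bind> refresh_X)"
    unfolding refresh_Y_def prod.case
    by (intro bind_assoc[where N=borel and R=borel])
      (auto simp: borel_prod intro: measurable_prob_algebraD)
  also have "\<dots> = \<kappa>Y x \<bind> (\<lambda>y'. refresh_X (x, y'))"
    using measurable_prob_algebraD[OF measurable_refresh(2)] by (simp add: bind_return)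
  finally show "gibbs_kernel \<kappa>Y \<kappa>X (x, y) = refresh_Y (x, y) \<bind> refresh_X"
    by (simp add: gibbs_kernel_def refresh_X_def)
qed

lemma adjoint_gibbs: "adjoint_kernels \<pi> \<pi> (gibbs_kernel \<kappa>Y \<kappa>X) (\<lambda>z. refresh_X z \<bind> refresh_Y)"
  using adjoint_kernels_bind[OF adjoint_refresh] by (simp add: gibbs_kernel_eq)

text \<open>The marginal kernel is \<open>\<kappa>Y\<close> followed by its own adjoint
  \<open>\<kappa>X\<close>, hence reversible.\<close>

lemma adjoint_marginal: "adjoint_kernels \<pi>X \<pi>X (marginal_kernel \<kappa>Y \<kappa>X) (marginal_kernel \<kappa>Y \<kappa>X)"
  using adjoint_kernels_bind[OF adjoint_conditionals adjoint_kernels_sym[OF adjoint_conditionals]]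
  by (simp add: marginal_kernel_def[abs_def])

lemma measurable_marginal_kernel: "marginal_kernel \<kappa>Y \<kappa>X \<in> borel \<rightarrow>\<^sub>M prob_algebra borel"
  unfolding marginal_kernel_def[abs_def] by (rule measurable_bind_prob_space) measurable

section \<open>Reduction to the marginal chain\<close>

lemma distr_gibbs_fst: "distr (gibbs_kernel \<kappa>Y \<kappa>X (x, y)) borel fst = marginal_kernel \<kappa>Y \<kappa>X x"
proof -
  have sX: "sets (\<kappa>X y') = sets borel" "space (\<kappa>X y') = UNIV" for y'
    using kernel_prob[OF measurable_\<kappa>(2)] by auto
  have sY: "sets (\<kappa>Y x) = sets borel" "space (\<kappa>Y x) = UNIV"
    using kernel_prob[OF measurable_\<kappa>(1)] by auto
  have fst: "fst \<in> (borel :: ('x \<times> 'y) measure) \<rightarrow>\<^sub>M borel"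
    unfolding borel_prod[symmetric] by measurable
  have 1: "(\<lambda>y'. \<kappa>X y' \<bind> (\<lambda>x'. return borel (x', y'))) \<in> \<kappa>Y x \<rightarrow>\<^sub>M subprob_algebra borel"
    unfolding borel_prod[symmetric]
    by (subst measurable_cong_sets[OF sY(1) refl], rule measurable_prob_algebraD) measurable
  have 2: "(\<lambda>x'. return borel (x', y')) \<in> \<kappa>X y' \<rightarrow>\<^sub>M subprob_algebra borel" for y'
    unfolding borel_prod[symmetric]
    by (subst measurable_cong_sets[OF sX(1) refl]) auto
  have "distr (gibbs_kernel \<kappa>Y \<kappa>X (x, y)) borel fst =
    \<kappa>Y x \<bind> (\<lambda>y'. distr (\<kappa>X y' \<bind> (\<lambda>x'. return borel (x', y'))) borel fst)"
    unfolding gibbs_kernel_def prod.case using sY by (intro distr_bind[OF 1 _ fst]) auto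
  also have "\<dots> = \<kappa>Y x \<bind> (\<lambda>y'. \<kappa>X y' \<bind> (\<lambda>x'. distr (return borel (x', y')) borel fst))"
    using sX by (subst distr_bind[OF 2 _ fst]) auto
  also have "\<dots> = \<kappa>Y x \<bind> (\<lambda>y'. \<kappa>X y' \<bind> (\<lambda>x'. return borel x'))"
    using fst by (simp add: distr_return)
  also have "\<dots> = \<kappa>Y x \<bind> \<kappa>X"
    using sX by (simp add: bind_return'')
  finally show ?thesis by (simp add: marginal_kernel_def)
qed

text \<open>Pushing the Gibbs kernel forward along \<open>fst\<close> gives the marginal kernel. The
  equality holds at every point, so it can be rewritten inside iterates.\<close>

lemma P_comp_fst:
  assumes "g \<in> borel_measurable borel"
  shows "P (g \<circ> fst) = PX g \<circ> fst"
proof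
  fix z :: "'x \<times> 'y"
  have fst: "fst \<in> (borel :: ('x \<times> 'y) measure) \<rightarrow>\<^sub>M borel"
    unfolding borel_prod[symmetric] by measurable
  have G: "gibbs_kernel \<kappa>Y \<kappa>X \<in> \<pi> \<rightarrow>\<^sub>M prob_algebra \<pi>"
    using adjoint_gibbs by (simp add: adjoint_kernels_def)
  have "sets (gibbs_kernel \<kappa>Y \<kappa>X z) = sets borel"
    using kernel_prob(2)[OF G, of z] sets_\<pi> sets_eq_imp_space_eq[OF sets_\<pi>] by simp
  then have "fst \<in> gibbs_kernel \<kappa>Y \<kappa>X z \<rightarrow>\<^sub>M borel"
    using fst by (simp cong: measurable_cong_sets)
  from integral_distr[OF this assms] show "P (g \<circ> fst) z = (PX g \<circ> fst) z"
    using distr_gibbs_fst[of "fst z" "snd z"] by (simp add: kernel_op_def)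
qed

lemma L20_comp_fst_iff: "g \<in> borel_measurable borel \<Longrightarrow> g \<circ> fst \<in> L20 \<pi> \<longleftrightarrow> g \<in> L20 \<pi>X"
  by (auto simp: L20_def L2_def integral_distr integrable_distr_eq comp_def)

lemma L2_norm_comp_fst: "g \<in> borel_measurable borel \<Longrightarrow> L2_norm \<pi> (g \<circ> fst) = L2_norm \<pi>X g"
  by (simp add: L2_norm_def integral_distr)

lemma P_eq_comp_fst:
  assumes "f \<in> L20 \<pi>"
  obtains h where "h \<in> L20 \<pi>X" "P f = h \<circ> fst"
proof
  \<comment> \<open>\<open>gibbs_kernel\<close> ignores the old second coordinate, so any value may
    stand there.\<close>
  define h where "h x = P f (x, undefined)" for x
  show eq: "P f = h \<circ> fst"
    by (auto simp: h_def fun_eq_iff kernel_op_def gibbs_kernel_def)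
  have L: "P f \<in> L20 \<pi>"
    using assms prob_space.finite_measure[OF prob] by (rule kernel_op_L20[OF adjoint_gibbs, rotated])
  then have "P f \<in> borel_measurable (borel \<Otimes>\<^sub>M borel)"
    by (simp add: L20_def L2_def measurable_cong_sets[OF sets_\<pi> refl] borel_prod)
  then have "h \<in> borel_measurable borel" unfolding h_def[abs_def] by measurable
  then show "h \<in> L20 \<pi>X" using L L20_comp_fst_iff eq by simp
qed

text \<open>The weak Poincare inequality divided by \<open>r\<^sup>2\<close> is the premise of
  \<open>wpi_Kstar_le\<close>. Here \<open>r\<close> is any positive bound on the oscillation: the
  first claim takes the oscillation of \<open>P f\<close>, the decay estimate one fixed bound for
  all iterates.\<close>

lemma Kstar_marginal_le:
  assumes wpi: "weak_poincare \<pi>X (L2_adjoint \<pi>X PX \<circ> PX) \<beta>"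
    and g: "g \<in> L20 \<pi>X" and r: "osc \<pi>X g \<le> ereal r" "0 < r"
  shows "wpi_Kstar \<beta> ((L2_norm \<pi>X g)\<^sup>2 / r\<^sup>2) \<le>
    ereal (((L2_norm \<pi>X g)\<^sup>2 - (L2_norm \<pi>X (PX g))\<^sup>2) / r\<^sup>2)"
proof (rule wpi_Kstar_le)
  have gL: "g \<in> L2 \<pi>X" using g by (simp add: L20_def)
  have "(L2_norm \<pi>X (PX g))\<^sup>2 \<le> (L2_norm \<pi>X g)\<^sup>2"
    unfolding L2_norm_square by (rule kernel_op_L2(2)[OF adjoint_marginal gL])
  then show "0 \<le> ((L2_norm \<pi>X g)\<^sup>2 - (L2_norm \<pi>X (PX g))\<^sup>2) / r\<^sup>2" by simp
  fix s :: real assume s: "0 < s"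
  let ?E = "dirichlet \<pi>X (L2_adjoint \<pi>X PX \<circ> PX) g"
  have E: "?E = (L2_norm \<pi>X g)\<^sup>2 - (L2_norm \<pi>X (PX g))\<^sup>2"
    by (rule dirichlet_adjoint_kernel[OF adjoint_marginal gL])
  have osc0: "0 \<le> osc \<pi>X g" by (rule osc_nonneg[OF prob_marginals(1) L2D(1)[OF gL]])
  have b: "0 \<le> \<beta> s" using wpi s by (simp add: weak_poincare_def)
  have "ereal ((L2_norm \<pi>X g)\<^sup>2) \<le> ereal (s * ?E) + ereal (\<beta> s) * (osc \<pi>X g)\<^sup>2"
    using wpi s g unfolding weak_poincare_def by blast
  also have "\<dots> \<le> ereal (s * ?E) + ereal (\<beta> s) * (ereal r)\<^sup>2"
    using b r osc0 unfolding power2_eq_square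
    by (intro add_left_mono ereal_mult_left_mono ereal_mult_mono) auto
  finally have "(L2_norm \<pi>X g)\<^sup>2 \<le> s * ?E + \<beta> s * r\<^sup>2" by simp
  then show "(L2_norm \<pi>X g)\<^sup>2 / r\<^sup>2 \<le> s * (((L2_norm \<pi>X g)\<^sup>2 - (L2_norm \<pi>X (PX g))\<^sup>2) / r\<^sup>2) + \<beta> s"
    using r by (simp add: E field_simps)
qed

section \<open>The two inequalities for the Gibbs sampler\<close>

lemma osc_comp_fst_le_iff:
  "g \<in> borel_measurable borel \<Longrightarrow> osc \<pi> (g \<circ> fst) \<le> ereal r \<longleftrightarrow> osc \<pi>X g \<le> ereal r"
  by (rule osc_distr_le_iff[OF prob measurable_\<pi>(1), symmetric])

lemma L20_\<pi>X_borel: "g \<in> L20 \<pi>X \<Longrightarrow> g \<in> borel_measurable borel"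
  by (simp add: L20_def L2_def)

lemma osc_P_le: "f \<in> L2 \<pi> \<Longrightarrow> osc \<pi> f \<le> ereal r \<Longrightarrow> osc \<pi> (P f) \<le> ereal r"
  by (rule osc_kernel_op_le[OF adjoint_gibbs prob prob])

lemma Kstar_gibbs_le_dirichlet:
  assumes wpi: "weak_poincare \<pi>X (L2_adjoint \<pi>X PX \<circ> PX) \<beta>"
    and f: "f \<in> L20 \<pi>" and osc: "osc \<pi> f < \<infinity>" and pos: "0 < osc \<pi> (P f)"
  shows "wpi_Kstar \<beta> ((L2_norm \<pi> (P f))\<^sup>2 / (real_of_ereal (osc \<pi> (P f)))\<^sup>2) \<le>
    ereal (dirichlet \<pi> (L2_adjoint \<pi> P \<circ> P) (P f) / (real_of_ereal (osc \<pi> (P f)))\<^sup>2)"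
proof -
  have fL: "f \<in> L2 \<pi>" using f by (simp add: L20_def)
  \<comment> \<open>Finiteness passes from \<open>f\<close> to \<open>P f\<close>, so
    \<open>real_of_ereal\<close> returns the true oscillation of \<open>P f\<close>.\<close>
  obtain R where "osc \<pi> f \<le> ereal R" using osc by (cases "osc \<pi> f") auto
  from osc_P_le[OF fL this] pos obtain r where r: "osc \<pi> (P f) = ereal r" "0 < r"
    by (cases "osc \<pi> (P f)") auto
  obtain h where h: "h \<in> L20 \<pi>X" "P f = h \<circ> fst" using P_eq_comp_fst[OF f] .
  note hm = L20_\<pi>X_borel[OF h(1)]
  have "osc \<pi>X h \<le> ereal r" using r h osc_comp_fst_le_iff[OF hm, of r] by simp
  from Kstar_marginal_le[OF wpi h(1) this r(2)]
  have "wpi_Kstar \<beta> ((L2_norm \<pi> (P f))\<^sup>2 / r\<^sup>2) \<le>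
      ereal (((L2_norm \<pi> (P f))\<^sup>2 - (L2_norm \<pi> (P (P f)))\<^sup>2) / r\<^sup>2)"
    using kernel_op_measurable[OF measurable_marginal_kernel hm]
    by (simp add: h(2) P_comp_fst[OF hm] L2_norm_comp_fst hm)
  then show ?thesis
    using dirichlet_adjoint_kernel[OF adjoint_gibbs kernel_op_L2(1)[OF adjoint_gibbs fL]] r by simp
qed

text \<open>The first application of \<open>P\<close> only makes the function depend on
  \<open>x\<close> alone; the remaining \<open>n\<close> are steps of the marginal chain. This is
  the source of the shift by one in the rate.\<close>

lemma L2_norm_gibbs_iterate_le:
  assumes wpi: "weak_poincare \<pi>X (L2_adjoint \<pi>X PX \<circ> PX) \<beta>"
    and Kstar_le: "\<forall>v\<in>{0..1/4}. wpi_Kstar \<beta> v \<le> ereal v"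
    and f: "f \<in> L20 \<pi>" and osc: "osc \<pi> f = ereal R" and R: "0 < R"
  shows "(L2_norm \<pi> ((P ^^ Suc n) f))\<^sup>2 \<le> R\<^sup>2 * wpi_F_inv \<beta> (real n)"
proof -
  interpret wpi_rate \<beta>
    by unfold_locales (use wpi Kstar_le in \<open>auto simp: weak_poincare_def\<close>)
  have fL: "f \<in> L2 \<pi>" using f by (simp add: L20_def)
  obtain h where h: "h \<in> L20 \<pi>X" "P f = h \<circ> fst" using P_eq_comp_fst[OF f] .
  let ?g = "\<lambda>n. (PX ^^ n) h"
  have g: "?g n \<in> L20 \<pi>X \<and> osc \<pi>X (?g n) \<le> ereal R" for n
  proof (induction n)
    case 0
    then show ?case using h osc_P_le[OF fL, of R] osc osc_comp_fst_le_iff[OF L20_\<pi>X_borel[OF h(1)]] by simp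
  next
    case (Suc n)
    then show ?case
      using kernel_op_L20[OF adjoint_marginal prob_space.finite_measure[OF prob_marginals(1)]]
        osc_kernel_op_le[OF adjoint_marginal prob_marginals(1) prob_marginals(1)]
      by (auto simp: L20_def)
  qed
  note gm = L20_\<pi>X_borel[OF conjunct1[OF g]]
  have P_pow: "(P ^^ Suc n) f = ?g n \<circ> fst" for n
  proof (induction n)
    case (Suc n)
    then have "(P ^^ Suc (Suc n)) f = P (?g n \<circ> fst)" by (simp add: comp_def)
    then show ?case by (simp only: P_comp_fst[OF gm] funpow.simps comp_apply)
  qed (simp add: h(2))
  \<comment> \<open>The same \<open>R\<close> normalises every term, so that consecutive values
    differ exactly by the scaled drop of the squared norm.\<close>
  define v where "v n = (L2_norm \<pi>X (?g n))\<^sup>2 / R\<^sup>2" for n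
  have "v n \<le> wpi_F_inv \<beta> (real n)"
  proof (rule le_F_inv_of_recurrence)
    show "v 0 \<le> 1/4"
      using L2_norm_square_le_osc[OF prob_marginals(1), of "?g 0" R] g[of 0] R
      by (simp add: v_def field_simps)
    show "wpi_Kstar \<beta> (v n) \<le> ereal (v n - v (Suc n))" for n
      using Kstar_marginal_le[OF wpi, of "?g n" R] g[of n] R
      by (simp add: v_def diff_divide_distrib)
  qed
  then show ?thesis
    unfolding P_pow L2_norm_comp_fst[OF gm] using R by (simp add: v_def field_simps)
qed

end

theorem theorem3p5:
  fixes \<pi> :: "('x::polish_space \<times> 'y::polish_space) measure"
    and \<kappa>Y :: "'x \<Rightarrow> 'y measure" and \<kappa>X :: "'y \<Rightarrow> 'x measure"
    and \<beta> :: "real \<Rightarrow> real"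
  defines "\<pi>X \<equiv> distr \<pi> borel fst"
    and "P \<equiv> kernel_op (gibbs_kernel \<kappa>Y \<kappa>X)"
    and "PX \<equiv> kernel_op (marginal_kernel \<kappa>Y \<kappa>X)"
  assumes "prob_space \<pi>" and "sets \<pi> = sets borel"
    and "regular_conditional \<pi> fst snd \<kappa>Y"
    and "regular_conditional \<pi> snd fst \<kappa>X"
    and "weak_poincare \<pi>X (L2_adjoint \<pi>X PX \<circ> PX) \<beta>"
    and "\<forall>v\<in>{0..1/4}. wpi_Kstar \<beta> v \<le> ereal v"
  shows "\<forall>f\<in>L20 \<pi>. 0 < osc \<pi> f \<and> osc \<pi> f < \<infinity> \<longrightarrow>
    (0 < osc \<pi> (P f) \<longrightarrow>
       ereal (dirichlet \<pi> (L2_adjoint \<pi> P \<circ> P) (P f) / (real_of_ereal (osc \<pi> (P f)))\<^sup>2)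
         \<ge> wpi_Kstar \<beta> ((L2_norm \<pi> (P f))\<^sup>2 / (real_of_ereal (osc \<pi> (P f)))\<^sup>2)) \<and>
    (\<forall>n::nat. n \<ge> 2 \<longrightarrow>
       (L2_norm \<pi> ((P ^^ n) f))\<^sup>2 \<le> (real_of_ereal (osc \<pi> f))\<^sup>2 * wpi_F_inv \<beta> (real n - 1))"
proof (rule ballI, rule impI)
  interpret two_component_gibbs \<pi> \<kappa>Y \<kappa>X
    using assms(4-7) by (rule two_component_gibbs.intro)
  note wpi = assms(8)[unfolded PX_def \<pi>X_def]
  fix f assume f: "f \<in> L20 \<pi>" and osc: "0 < osc \<pi> f \<and> osc \<pi> f < \<infinity>"
  then obtain R where R: "osc \<pi> f = ereal R" "0 < R"
    by (cases "osc \<pi> f") auto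
  have "(L2_norm \<pi> ((P ^^ n) f))\<^sup>2 \<le> (real_of_ereal (osc \<pi> f))\<^sup>2 * wpi_F_inv \<beta> (real n - 1)"
    if "2 \<le> n" for n
  proof -
    from that obtain m where "n = Suc m" by (cases n) auto
    then show ?thesis
      using L2_norm_gibbs_iterate_le[OF wpi assms(9) f R, of m] unfolding P_def by (simp add: R(1))
  qed
  then show "(0 < osc \<pi> (P f) \<longrightarrow>
       ereal (dirichlet \<pi> (L2_adjoint \<pi> P \<circ> P) (P f) / (real_of_ereal (osc \<pi> (P f)))\<^sup>2)
         \<ge> wpi_Kstar \<beta> ((L2_norm \<pi> (P f))\<^sup>2 / (real_of_ereal (osc \<pi> (P f)))\<^sup>2)) \<and>
    (\<forall>n::nat. n \<ge> 2 \<longrightarrow>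
       (L2_norm \<pi> ((P ^^ n) f))\<^sup>2 \<le> (real_of_ereal (osc \<pi> f))\<^sup>2 * wpi_F_inv \<beta> (real n - 1))"
    using Kstar_gibbs_le_dirichlet[OF wpi f conjunct2[OF osc]] unfolding P_def by blast
qed

end
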